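(* Let $q$ be a (conservative stable) $Q$-function on the nonempty Borel space $S$. The (nonhomogeneous) Markov pure jump process $(X_t)$ with transition function $P_q$ is explosive if and only if for some $\alpha>0$ there is a bounded nonnegative measurable function $U$ on $[0,\infty)\times S$, nontrivial in the sense that $U(v,x)\ne0$ for some $(v,x)$, satisfying $$U(v,x)\le\int_0^\infty\int_SU(v+t,y)\,\tilde q(dy|x,v+t)\,e^{-\alpha t-\int_0^tq_x(s+v)ds}\,dt\quad\forall x\in S,\ v\in[0,\infty).$$
   Context: $S$ is a nonempty Borel space with Borel $\sigma$-algebra $\mathcal B(S)$; measurability means Borel measurability. A (conservative stable) $Q$-function on $S$ is a Borel-measurable signed kernel $q(dy|x,s)$ on $\mathcal B(S)$ from $S\times[0,\infty)$ such that (1) $0\le q(\Gamma|x,s)<\infty$ whenever $x\notin\Gamma\in\mathcal B(S)$, (2) $q(S|x,s)=0$ for all $(x,s)$, (3) $\sup_{s\ge0}q(S\setminus\{x\}|x,s)<\infty$ for each $x\in S$. Put $\tilde q(\Gamma|x,s):=q(\Gamma\setminus\{x\}|x,s)$ and $q_x(s):=-q(\{x\}|x,s)$. The $q$-transition function is $P_q:=\sum_{n\ge0}P_q^{(n)}$, where for $0\le s\le t<\infty$, $P_q^{(0)}(s,x,t,\Gamma)=\delta_x(\Gamma)e^{-\int_s^tq_x(v)dv}$ and $P_q^{(n+1)}(s,x,t,\Gamma)=\int_s^te^{-\int_s^uq_x(v)dv}\left(\int_SP_q^{(n)}(u,z,t,\Gamma)\tilde q(dz|x,u)\right)du$. The Markov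 pure jump process $(X_t)$ with transition function $P_q$ and initial state $x\in S$ (law $\mathbb P^q_x$): $x_0=x$, $t_0=0$, and, given the past up to the jump moment $t_n<\infty$ with post-jump state $x_n\in S$, the next pair $(t_{n+1},x_{n+1})$ has conditional law $e^{-\int_{t_n}^tq_{x_n}(v)dv}\tilde q(dy|x_n,t)\,dt$ on $(t_n,\infty)\times S$, the remaining mass being put on $t_{n+1}=\infty$, $x_{n+1}=x_\infty$, where $x_\infty\notin S$ is an isolated cemetery point; $X_t=x_n$ for $t_n\le t<t_{n+1}$ and $X_t=x_\infty$ for $t\ge t_\infty:=\lim_nt_n$. The process is nonexplosive if $\mathbb P_x^q(t_\infty=\infty)=1$ for all $x\in S$, and explosive if $\mathbb P_x^q(t_\infty=\infty)<1$ for some $x\in S$. *)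

theory Defs
  imports "HOL-Probability.Probability"
begin

text \<open>
  A Borel space is a nonempty Borel subset \<open>S\<close> of a Polish space, with the trace of the Borel
  \<open>\<sigma>\<close>-algebra. The value written \<open>q(\<Gamma>|x,s)\<close> in the literature is \<open>q x s \<Gamma>\<close> here; only
  \<open>x \<in> S\<close>, \<open>s \<ge> 0\<close> and Borel \<open>\<Gamma> \<subseteq> S\<close> are meaningful.
\<close>

abbreviation borel_on :: "'a::topological_space set \<Rightarrow> 'a measure" where
  "borel_on S \<equiv> restrict_space borel S"

definition signed_kernel ::
  "'a::polish_space set \<Rightarrow> ('a \<Rightarrow> real \<Rightarrow> 'a set \<Rightarrow> real) \<Rightarrow> bool" where
  "signed_kernel S q \<longleftrightarrow>
     (\<forall>x\<in>S. \<forall>s\<ge>0. q x s {} = 0 \<and>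
        (\<forall>A::nat \<Rightarrow> 'a set. range A \<subseteq> sets (borel_on S) \<longrightarrow> disjoint_family A \<longrightarrow>
           (\<lambda>i. q x s (A i)) sums q x s (\<Union>i. A i))) \<and>
     (\<forall>\<Gamma>\<in>sets (borel_on S).
        (\<lambda>(x, s). q x s \<Gamma>) \<in> borel_measurable (borel_on S \<Otimes>\<^sub>M borel_on {0..}))"

text \<open>
  Conservative stable \<open>Q\<close>-functions. Real values are no restriction: the finiteness of
  \<open>q(\<Gamma>|x,s)\<close> for \<open>x \<notin> \<Gamma>\<close> and \<open>q(S|x,s) = 0\<close> force \<open>q(\<cdot>|x,s)\<close> to be finite.
\<close>

definition Q_function ::
  "'a::polish_space set \<Rightarrow> ('a \<Rightarrow> real \<Rightarrow> 'a set \<Rightarrow> real) \<Rightarrow> bool" where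
  "Q_function S q \<longleftrightarrow>
     signed_kernel S q \<and>
     (\<forall>x\<in>S. \<forall>s\<ge>0. \<forall>\<Gamma>\<in>sets (borel_on S). x \<notin> \<Gamma> \<longrightarrow> 0 \<le> q x s \<Gamma>) \<and>
     (\<forall>x\<in>S. \<forall>s\<ge>0. q x s S = 0) \<and>
     (\<forall>x\<in>S. bdd_above ((\<lambda>s. q x s (S - {x})) ` {0..}))"

definition q_tilde ::
  "'a::polish_space set \<Rightarrow> ('a \<Rightarrow> real \<Rightarrow> 'a set \<Rightarrow> real) \<Rightarrow> 'a \<Rightarrow> real \<Rightarrow> 'a measure" where
  "q_tilde S q x s = measure_of S (sets (borel_on S)) (\<lambda>\<Gamma>. ennreal (q x s (\<Gamma> - {x})))"

definition q_rate :: "('a \<Rightarrow> real \<Rightarrow> 'a set \<Rightarrow> real) \<Rightarrow> 'a \<Rightarrow> real \<Rightarrow> real" where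
  "q_rate q x s = - q x s {x}"

text \<open>
  States of the jump chain are pairs \<open>(t\<^sub>n, x\<^sub>n)\<close> with \<open>t\<^sub>n \<in> [0,\<infty>]\<close> and \<open>x\<^sub>n\<close> in \<open>S\<close> enlarged by
  the isolated cemetery point, which is rendered as \<open>None\<close>.
\<close>

definition cemetery_space :: "'a::polish_space set \<Rightarrow> 'a option measure" where
  "cemetery_space S =
     sigma (insert None (Some ` S))
       {A. A \<subseteq> insert None (Some ` S) \<and> Some -` A \<in> sets (borel_on S)}"

definition jump_space :: "'a::polish_space set \<Rightarrow> (ennreal \<times> 'a option) measure" where
  "jump_space S = borel \<Otimes>\<^sub>M cemetery_space S"

text \<open>
  Mass that \<open>e\<^bsup>-\<integral>q\<^sub>x(w)dw\<^esup> q~(dy|x,u) du\<close> on \<open>(t,\<infty>) \<times> S\<close>, the integral in the exponent being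
  over \<open>[t,u]\<close>, gives to \<open>B\<close>.
\<close>

definition jump_mass ::
  "'a::polish_space set \<Rightarrow> ('a \<Rightarrow> real \<Rightarrow> 'a set \<Rightarrow> real) \<Rightarrow> real \<Rightarrow> 'a \<Rightarrow>
     (ennreal \<times> 'a option) set \<Rightarrow> ennreal" where
  "jump_mass S q t x B =
     (\<integral>\<^sup>+u. ennreal (exp (- (LBINT w:{t..u}. q_rate q x w))) *
            (\<integral>\<^sup>+y. indicator B (ennreal u, Some y) \<partial>q_tilde S q x u) * indicator {t<..} u \<partial>lborel)"

definition jump_law ::
  "'a::polish_space set \<Rightarrow> ('a \<Rightarrow> real \<Rightarrow> 'a set \<Rightarrow> real) \<Rightarrow> real \<Rightarrow> 'a \<Rightarrow>
     (ennreal \<times> 'a option) measure" where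
  "jump_law S q t x =
     measure_of (space (jump_space S)) (sets (jump_space S))
       (\<lambda>B. jump_mass S q t x B +
            (1 - jump_mass S q t x (space (jump_space S))) * indicator B (\<infinity>, None))"

text \<open>
  Once \<open>(\<infinity>, None)\<close> is reached the chain stays there; the remaining pairs \<open>(t, None)\<close> with
  \<open>t < \<infinity>\<close> and \<open>(\<infinity>, Some x)\<close> are never visited.
\<close>

definition next_jump ::
  "'a::polish_space set \<Rightarrow> ('a \<Rightarrow> real \<Rightarrow> 'a set \<Rightarrow> real) \<Rightarrow> ennreal \<times> 'a option \<Rightarrow>
     (ennreal \<times> 'a option) measure" where
  "next_jump S q = (\<lambda>(t, z).
     case z of
       Some x \<Rightarrow> if t < \<infinity> then jump_law S q (enn2real t) x else return (jump_space S) (\<infinity>, None)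
     | None \<Rightarrow> return (jump_space S) (\<infinity>, None))"

primrec jump_kernel ::
  "'a::polish_space set \<Rightarrow> ('a \<Rightarrow> real \<Rightarrow> 'a set \<Rightarrow> real) \<Rightarrow> 'a \<Rightarrow> nat \<Rightarrow>
     (nat \<Rightarrow> ennreal \<times> 'a option) \<Rightarrow> (ennreal \<times> 'a option) measure" where
  "jump_kernel S q x 0 \<omega> = return (jump_space S) (0, Some x)"
| "jump_kernel S q x (Suc n) \<omega> = next_jump S q (\<omega> n)"

text \<open>
  The law of the pure jump process started in \<open>x\<close> at time \<open>0\<close>: the Ionescu-Tulcea measure on
  trajectories \<open>n \<mapsto> (t\<^sub>n, x\<^sub>n)\<close>, which determine the path of the process by \<open>X\<^sub>t = x\<^sub>n\<close> on
  \<open>[t\<^sub>n, t\<^sub>n\<^sub>+\<^sub>1)\<close> and \<open>X\<^sub>t = None\<close> from the explosion time on.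
\<close>

definition jump_process ::
  "'a::polish_space set \<Rightarrow> ('a \<Rightarrow> real \<Rightarrow> 'a set \<Rightarrow> real) \<Rightarrow> 'a \<Rightarrow>
     (nat \<Rightarrow> ennreal \<times> 'a option) measure" where
  "jump_process S q x =
     projective_family.lim UNIV
       (Ionescu_Tulcea.CI (jump_kernel S q x) (\<lambda>_. jump_space S)) (\<lambda>_. jump_space S)"

definition explosion_time :: "(nat \<Rightarrow> ennreal \<times> 'a option) \<Rightarrow> ennreal" where
  "explosion_time \<omega> = lim (\<lambda>n. fst (\<omega> n))"

definition explosive ::
  "'a::polish_space set \<Rightarrow> ('a \<Rightarrow> real \<Rightarrow> 'a set \<Rightarrow> real) \<Rightarrow> bool" where
  "explosive S q \<longleftrightarrow>
     (\<exists>x\<in>S. \<P>(\<omega> in jump_process S q x. explosion_time \<omega> = \<infinity>) < 1)"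

end

theory Submission
  imports Defs
begin

text \<open>
  Let \<open>D f(v, x)\<close> be the right-hand side of the inequality with \<open>U\<close> replaced by \<open>f\<close>, so that the
  condition on \<open>U\<close> reads \<open>U \<le> D U\<close>. Since \<open>D\<close> is monotone with \<open>D 1 \<le> 1\<close>, the iterates \<open>D\<^sup>n 1\<close> decrease
  to some \<open>h\<close>; by monotone convergence \<open>D h = h\<close>, and \<open>U \<le> C\<close> with \<open>U \<le> D U\<close> forces \<open>U \<le> C h\<close>. Hence a
  nontrivial \<open>U\<close> exists iff \<open>h \<noteq> 0\<close>. By the Markov property of the chain of jumps,
  \<open>D\<^sup>n 1 (0, x)\<close> is the expectation of \<open>exp (- \<alpha> t\<^sub>n)\<close> under the law started in \<open>x\<close> (with value \<open>0\<close>
  if \<open>t\<^sub>n = \<infinity>\<close>), so \<open>h (0, x) = 0\<close> iff the explosion time is almost surely infinite. Finally, the bounded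
  rate lets the process rest in \<open>x\<close> until time \<open>v\<close> with positive probability, so
  \<open>h (v, x) \<noteq> 0\<close> for some \<open>v\<close> implies \<open>h (0, x) \<noteq> 0\<close>.
\<close>

section \<open>Hazard rates\<close>

text \<open>Dividing the increment by \<open>y - x\<close> leaves a bound of order
  \<open>\<bar>y - x\<bar>\<close>, so the derivative is zero on the convex set
  \<open>{t..}\<close>.\<close>

lemma quadratic_increment_imp_constant:
  fixes f :: "real \<Rightarrow> real"
  assumes "\<And>x y. t \<le> x \<Longrightarrow> x \<le> y \<Longrightarrow> \<bar>f y - f x\<bar> \<le> C * (y - x)\<^sup>2" and "t \<le> u"
  shows "f u = f t"
proof -
  have "((f has_derivative (\<lambda>h. 0)) (at x within {t..}))" if x: "x \<in> {t..}" for x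
    unfolding has_derivative_within
  proof (intro conjI)
    \<comment> \<open>The hypothesis only compares ordered arguments and leaves the sign of
      \<open>C\<close> open; this is its symmetric form with a nonnegative constant.\<close>
    have bound: "\<bar>f y - f x\<bar> \<le> \<bar>C\<bar> * (y - x)\<^sup>2" if "y \<in> {t..}" for y
    proof -
      have "\<bar>f y - f x\<bar> \<le> C * (y - x)\<^sup>2"
        using assms(1)[of x y] assms(1)[of y x] x that
        by (cases "x \<le> y") (auto simp: abs_minus_commute power2_commute)
      also have "\<dots> \<le> \<bar>C\<bar> * (y - x)\<^sup>2" by (intro mult_right_mono) auto
      finally show ?thesis .
    qed
    have "((\<lambda>y. \<bar>C\<bar> * \<bar>y - x\<bar>) \<longlongrightarrow> \<bar>C\<bar> * \<bar>x - x\<bar>) (at x within {t..})"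
      by (intro tendsto_intros)
    then have lim: "((\<lambda>y. \<bar>C\<bar> * \<bar>y - x\<bar>) \<longlongrightarrow> 0) (at x within {t..})" by simp
    show "((\<lambda>y. (1 / norm (y - x)) *\<^sub>R (f y - (f x + 0))) \<longlongrightarrow> 0) (at x within {t..})"
    proof (rule tendsto_0_le[OF lim, of _ 1])
      show "\<forall>\<^sub>F y in at x within {t..}.
          norm ((1 / norm (y - x)) *\<^sub>R (f y - (f x + 0))) \<le> norm (\<bar>C\<bar> * \<bar>y - x\<bar>) * 1"
        unfolding eventually_at_filter
        by (rule always_eventually)
          (use bound in \<open>auto simp: divide_simps abs_mult power2_eq_square mult_ac\<close>)
    qed
  qed auto
  from has_derivative_zero_constant[OF _ this] obtain c where "\<And>x. x \<in> {t..} \<Longrightarrow> f x = c"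
    by auto
  with \<open>t \<le> u\<close> show ?thesis by auto
qed

text \<open>Both follow from \<open>1 - d \<le> exp (- d)\<close> and
  \<open>exp (- d) \<le> 1 / (1 + d)\<close>. The numbers \<open>d\<close> and
  \<open>d * exp (- d)\<close> will be upper and lower estimates for the jump probability
  \<open>1 - exp (- d)\<close> on a short interval with accumulated rate \<open>d\<close>.\<close>

lemma exp_minus_quadratic_bounds:
  fixes d :: real assumes "0 \<le> d"
  shows "\<bar>d - (1 - exp (- d))\<bar> \<le> d\<^sup>2" and "\<bar>d * exp (- d) - (1 - exp (- d))\<bar> \<le> d\<^sup>2"
proof -
  have lo: "1 - d \<le> exp (- d)" using exp_ge_add_one_self[of "- d"] by simp
  have "exp (- d) \<le> 1 / (1 + d)"
    using exp_ge_add_one_self[of d] assms by (simp add: exp_minus field_simps)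
  also have "\<dots> \<le> 1 - d + d\<^sup>2"
    using assms by (simp add: divide_simps power2_eq_square) (simp add: algebra_simps)
  finally have hi: "exp (- d) \<le> 1 - d + d\<^sup>2" .
  show "\<bar>d - (1 - exp (- d))\<bar> \<le> d\<^sup>2" using lo hi by auto
  have "(1 - d) * (1 + d) \<le> exp (- d) * (1 + d)"
    using lo assms by (intro mult_right_mono) auto
  moreover have "d * exp (- d) \<le> d * 1"
    using assms by (intro mult_left_mono) auto
  ultimately show "\<bar>d * exp (- d) - (1 - exp (- d))\<bar> \<le> d\<^sup>2"
    using lo hi by (auto simp: algebra_simps power2_eq_square abs_le_iff)
qed

text \<open>The moving interval becomes a measurable condition on the pair, after which this is
  measurability of a parameter integral over a fixed measure.\<close>

lemma borel_measurable_set_integral_param: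
  fixes f :: "'a \<times> real \<Rightarrow> real"
  assumes [measurable]: "f \<in> borel_measurable (M \<Otimes>\<^sub>M lborel)" "g \<in> borel_measurable M" "h \<in> borel_measurable M"
  shows "(\<lambda>x. LBINT w:{g x..h x}. f (x, w)) \<in> borel_measurable M"
proof -
  have sets_eq: "sets (M \<Otimes>\<^sub>M lborel) = sets (M \<Otimes>\<^sub>M (borel :: real measure))"
    by (intro sets_pair_measure_cong) auto
  have [measurable]: "Measurable.pred (M \<Otimes>\<^sub>M lborel) (\<lambda>p. g (fst p) \<le> snd p \<and> snd p \<le> h (fst p))"
    unfolding measurable_cong_sets[OF sets_eq refl] by measurable
  have "(\<lambda>p. if g (fst p) \<le> snd p \<and> snd p \<le> h (fst p) then f p else 0)
      \<in> borel_measurable (M \<Otimes>\<^sub>M lborel)"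
    by measurable
  then have "(\<lambda>x. LBINT w. (if g x \<le> w \<and> w \<le> h x then f (x, w) else 0)) \<in> borel_measurable M"
    by (intro lborel.borel_measurable_lebesgue_integral) (simp add: case_prod_beta')
  then show ?thesis
    by (simp add: set_lebesgue_integral_def indicator_def atLeastAtMost_iff if_distrib
        cong: if_cong)
qed

section \<open>Integrals of a bounded measurable rate and the law of its first event\<close>

context
  fixes a :: "real \<Rightarrow> real" and M :: real
  assumes a[measurable]: "a \<in> borel_measurable borel"
    and bounds: "\<And>u. 0 \<le> a u" "\<And>u. a u \<le> M"
begin

lemma set_integrable_bounded_rate: "set_integrable lborel {s..u} a"
  unfolding set_integrable_def
  by (rule integrableI_bounded_set_indicator[where B=M])
    (use bounds in \<open>auto simp: emeasure_lborel_Icc_eq abs_of_nonneg\<close>)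

lemma set_integral_rate_split:
  assumes "t \<le> u" "u \<le> v"
  shows "(LBINT w:{t..v}. a w) = (LBINT w:{t..u}. a w) + (LBINT w:{u..v}. a w)"
proof -
  have "(LBINT w:{t..v}. a w) = (LBINT w:{t..u} \<union> {u..v}. a w)"
    using assms by (simp add: ivl_disj_un_two_touch)
  also have "\<dots> = (LBINT w:{t..u}. a w) + (LBINT w:{u..v}. a w)"
  proof (rule set_integral_Un_AE)
    show "AE x in lborel. \<not> (x \<in> {t..u} \<and> x \<in> {u..v})"
      using AE_lborel_singleton[of u] by eventually_elim auto
  qed (auto intro: set_integrable_bounded_rate)
  finally show ?thesis .
qed

lemma set_integral_rate_bounds:
  assumes "u \<le> v"
  shows "0 \<le> (LBINT w:{u..v}. a w)" "(LBINT w:{u..v}. a w) \<le> M * (v - u)"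
proof -
  show "0 \<le> (LBINT w:{u..v}. a w)"
    unfolding set_lebesgue_integral_def by (intro integral_nonneg_AE) (auto simp: bounds)
  have "(LBINT w:{u..v}. a w) \<le> (LBINT w:{u..v}. M)"
    by (intro set_integral_mono set_integrable_bounded_rate) (auto simp: bounds set_integrable_def emeasure_lborel_Icc_eq)
  also have "\<dots> = M * (v - u)"
    using assms by (simp add: set_lebesgue_integral_def)
  finally show "(LBINT w:{u..v}. a w) \<le> M * (v - u)" .
qed

lemma set_integral_rate_nonneg: "0 \<le> (LBINT w:{u..v}. a w)"
  unfolding set_lebesgue_integral_def by (intro integral_nonneg_AE) (auto simp: bounds)

lemma measurable_set_integral_rate[measurable]:
  "(\<lambda>u. LBINT w:{t..u}. a w) \<in> borel_measurable borel"
  by (rule borel_measurable_set_integral_param[where f="\<lambda>(u, w). a w", simplified]) auto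

text \<open>The hazard rate is merely measurable, so the fundamental theorem of calculus does not apply;
  instead the integral up to \<open>u\<close> plus the survival probability has quadratic increments.\<close>

lemma set_integral_hazard_rate:
  assumes "t \<le> u"
  shows "(LBINT w:{t..u}. a w * exp (- (LBINT s:{t..w}. a s))) = 1 - exp (- (LBINT s:{t..u}. a s))"
proof -
  define A where "A u = (LBINT s:{t..u}. a s)" for u
  define g where "g w = a w * exp (- A w)" for w
  have A_split: "A y = A x + (LBINT w:{x..y}. a w)" if "t \<le> x" "x \<le> y" for x y
    unfolding A_def by (rule set_integral_rate_split) fact+
  have A_meas[measurable]: "A \<in> borel_measurable borel" unfolding A_def by measurable
  have g_meas[measurable]: "g \<in> borel_measurable borel" unfolding g_def by measurable
  have A0: "0 \<le> A u" for u unfolding A_def by (rule set_integral_rate_nonneg)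
  have g_bd: "0 \<le> g w" "g w \<le> M" for w
  proof -
    show "0 \<le> g w" by (simp add: g_def bounds)
    have "a w * exp (- A w) \<le> M * 1"
      using bounds[of w] A0[of w] by (intro mult_mono) (auto intro: order_trans)
    then show "g w \<le> M" by (simp add: g_def)
  qed
  have g_int: "set_integrable lborel {x..y} g" for x y
    unfolding set_integrable_def
    by (rule integrableI_bounded_set_indicator[where B=M])
      (use g_bd in \<open>auto simp: emeasure_lborel_Icc_eq abs_of_nonneg\<close>)
  define \<psi> where "\<psi> u = (LBINT w:{t..u}. g w) + exp (- A u)" for u
  have "\<bar>\<psi> y - \<psi> x\<bar> \<le> M\<^sup>2 * (y - x)\<^sup>2" if xy: "t \<le> x" "x \<le> y" for x y
  proof -
    define D where "D = (LBINT w:{x..y}. a w)"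
    have D: "0 \<le> D" "D \<le> M * (y - x)" and AD: "A y = A x + D"
      using set_integral_rate_bounds[OF xy(2)] A_split[OF xy] by (auto simp: D_def)
    define F where "F = (LBINT w:{x..y}. g w)"
    have "(LBINT w:{t..y}. g w) = (LBINT w:{t..x} \<union> {x..y}. g w)"
      using xy by (simp add: ivl_disj_un_two_touch)
    also have "\<dots> = (LBINT w:{t..x}. g w) + F" unfolding F_def
    proof (rule set_integral_Un_AE)
      show "AE w in lborel. \<not> (w \<in> {t..x} \<and> w \<in> {x..y})"
        using AE_lborel_singleton[of x] by eventually_elim auto
    qed (auto intro: g_int)
    finally have \<psi>: "\<psi> y - \<psi> x = F - exp (- A x) * (1 - exp (- D))"
      by (simp add: \<psi>_def AD algebra_simps flip: exp_add)
    \<comment> \<open>On \<open>{x..y}\<close> the survival factor falls from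
      \<open>exp (- A x)\<close> to \<open>exp (- A x) * exp (- D)\<close>. This traps
      \<open>F\<close> between \<open>exp (- A x) * (D * exp (- D))\<close> and
      \<open>exp (- A x) * D\<close>.\<close>
    have Aw: "A x \<le> A w" "A w \<le> A x + D" if "w \<in> {x..y}" for w
      using A_split[of x w] A_split[of w y] AD xy that set_integral_rate_nonneg[of x w]
        set_integral_rate_nonneg[of w y] by auto
    have "F \<le> (LBINT w:{x..y}. exp (- A x) * a w)" unfolding F_def
    proof (intro set_integral_mono g_int)
      show "set_integrable lborel {x..y} (\<lambda>w. exp (- A x) * a w)"
        by (intro set_integrable_mult_right set_integrable_bounded_rate)
    qed (use Aw bounds in \<open>auto simp: g_def mult.commute intro!: mult_left_mono\<close>)
    then have F_hi: "F \<le> exp (- A x) * D" by (simp add: D_def)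
    have "(LBINT w:{x..y}. exp (- (A x + D)) * a w) \<le> F" unfolding F_def
    proof (intro set_integral_mono g_int)
      show "set_integrable lborel {x..y} (\<lambda>w. exp (- (A x + D)) * a w)"
        by (intro set_integrable_mult_right set_integrable_bounded_rate)
    qed (use Aw bounds in \<open>fastforce simp: g_def mult.commute intro!: mult_left_mono\<close>)
    then have "exp (- (A x + D)) * D \<le> F" by (simp add: D_def)
    moreover have "exp (- (A x + D)) = exp (- A x) * exp (- D)"
      using exp_add[of "- A x" "- D"] by simp
    ultimately have F_lo: "exp (- A x) * (D * exp (- D)) \<le> F" by (simp add: mult_ac)
    have e: "0 \<le> exp (- A x)" "exp (- A x) \<le> 1" using A0[of x] by auto
    \<comment> \<open>The increment of \<open>\<psi>\<close> is \<open>F\<close> minus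
      \<open>exp (- A x) * (1 - exp (- D))\<close>, and either bound on \<open>F\<close> misses this
      value by at most \<open>D\<^sup>2\<close>, which is quadratic in \<open>y - x\<close> because
      the rate is bounded.\<close>
    have "\<psi> y - \<psi> x \<le> exp (- A x) * (D - (1 - exp (- D)))"
      using \<psi> F_hi by (simp add: algebra_simps)
    also have "\<dots> \<le> 1 * D\<^sup>2"
      using e exp_minus_quadratic_bounds[OF D(1)] exp_ge_add_one_self[of "- D"]
      by (intro mult_mono) auto
    finally have 1: "\<psi> y - \<psi> x \<le> D\<^sup>2" by simp
    have "- (\<psi> y - \<psi> x) \<le> exp (- A x) * ((1 - exp (- D)) - D * exp (- D))"
      using \<psi> F_lo by (simp add: algebra_simps)
    also have "\<dots> \<le> exp (- A x) * D\<^sup>2"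
      using e exp_minus_quadratic_bounds(2)[OF D(1)] by (intro mult_left_mono) auto
    also have "\<dots> \<le> 1 * D\<^sup>2" using e by (intro mult_right_mono) auto
    finally have "\<bar>\<psi> y - \<psi> x\<bar> \<le> D\<^sup>2" using 1 by auto
    also have "\<dots> \<le> (M * (y - x))\<^sup>2" using D by (intro power_mono) auto
    finally show ?thesis by (simp add: power_mult_distrib)
  qed
  then have "\<psi> u = \<psi> t" using assms by (rule quadratic_increment_imp_constant)
  \<comment> \<open>At \<open>u = t\<close> the integrals run over a null set, so the constant value
    of \<open>\<psi>\<close> is 1.\<close>
  moreover have "set_lebesgue_integral lborel {t..t} h = 0" for h :: "real \<Rightarrow> real"
    unfolding set_lebesgue_integral_def
    using AE_lborel_singleton[of t] by (intro integral_eq_zero_AE) (auto elim!: eventually_mono)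
  ultimately show ?thesis by (simp add: \<psi>_def A_def g_def)
qed

text \<open>Exhausting the half-line by \<open>{t..t + real n}\<close> gives the masses
  \<open>1 - exp (...)\<close>, each at most 1; the deficit in the limit is the probability that no
  jump ever happens.\<close>

lemma nn_integral_hazard_rate_le_1:
  "(\<integral>\<^sup>+u. ennreal (a u * exp (- (LBINT w:{t..u}. a w))) * indicator {t<..} u \<partial>lborel) \<le> 1"
proof -
  define g where "g u = a u * exp (- (LBINT w:{t..u}. a w))" for u
  have [measurable]: "g \<in> borel_measurable borel" unfolding g_def by measurable
  have g0: "0 \<le> g u" for u by (simp add: g_def bounds)
  have "(\<integral>\<^sup>+u. ennreal (g u) * indicator {t<..} u \<partial>lborel)
      \<le> (\<integral>\<^sup>+u. (SUP n. ennreal (g u) * indicator {t..t + real n} u) \<partial>lborel)"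
  proof (rule nn_integral_mono)
    fix u
    obtain n where "u - t \<le> real n" using real_arch_simple by blast
    then show "ennreal (g u) * indicator {t<..} u \<le> (SUP n. ennreal (g u) * indicator {t..t + real n} u)"
      by (intro SUP_upper2[of n]) (auto split: split_indicator)
  qed
  also have "\<dots> = (SUP n. \<integral>\<^sup>+u. ennreal (g u) * indicator {t..t + real n} u \<partial>lborel)"
    by (intro nn_integral_monotone_convergence_SUP)
      (auto simp: incseq_def le_fun_def split: split_indicator)
  also have "\<dots> \<le> 1"
  proof (rule SUP_least)
    fix n
    have le: "g u \<le> M" for u
    proof -
      have "a u * exp (- (LBINT w:{t..u}. a w)) \<le> M * 1"
        using bounds[of u] set_integral_rate_nonneg[of t u]
        by (intro mult_mono) (auto intro: order_trans)
      then show ?thesis by (simp add: g_def)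
    qed
    have "integrable lborel (\<lambda>u. indicator {t..t + real n} u *\<^sub>R g u)"
      by (rule integrableI_bounded_set_indicator[where B=M])
        (use g0 le in \<open>auto simp: emeasure_lborel_Icc_eq abs_of_nonneg\<close>)
    then have "(\<integral>\<^sup>+u. ennreal (indicator {t..t + real n} u *\<^sub>R g u) \<partial>lborel)
        = ennreal (LBINT u:{t..t + real n}. g u)"
      unfolding set_lebesgue_integral_def by (intro nn_integral_eq_integral) (auto simp: g0)
    also have "\<dots> \<le> 1"
      unfolding g_def by (subst set_integral_hazard_rate) auto
    also have "(\<integral>\<^sup>+u. ennreal (indicator {t..t + real n} u *\<^sub>R g u) \<partial>lborel)
        = (\<integral>\<^sup>+u. ennreal (g u) * indicator {t..t + real n} u \<partial>lborel)"
      by (intro nn_integral_cong) (auto split: split_indicator)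
    finally show "(\<integral>\<^sup>+u. ennreal (g u) * indicator {t..t + real n} u \<partial>lborel) \<le> 1" .
  qed
  finally show ?thesis by (simp add: g_def)
qed

end

section \<open>Kernels of a Q-function\<close>

lemma space_borel_on [simp]: "space (borel_on S) = S"
  by (simp add: space_restrict_space)

locale Q_process =
  fixes S :: "'a::polish_space set" and q :: "'a \<Rightarrow> real \<Rightarrow> 'a set \<Rightarrow> real"
  assumes S_borel: "S \<in> sets borel" and S_nonempty: "S \<noteq> {}" and Q: "Q_function S q"
begin

lemma borel_on_into: "A \<in> sets (borel_on S) \<Longrightarrow> A \<subseteq> S"
  using sets.sets_into_space[of A "borel_on S"] by simp

lemma S_sets [measurable, simp]: "S \<in> sets (borel_on S)"
  using sets.top[of "borel_on S"] by simp

lemma singleton_sets [measurable, simp]: "x \<in> S \<Longrightarrow> {x} \<in> sets (borel_on S)"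
  using S_borel by (auto simp: sets_restrict_space_iff)

lemma q_sums:
  assumes "x \<in> S" "0 \<le> s" "range A \<subseteq> sets (borel_on S)" "disjoint_family (A :: nat \<Rightarrow> 'a set)"
  shows "(\<lambda>i. q x s (A i)) sums q x s (\<Union>i. A i)"
  using Q assms unfolding Q_function_def signed_kernel_def by blast

lemma q_empty: "x \<in> S \<Longrightarrow> 0 \<le> s \<Longrightarrow> q x s {} = 0"
  using Q unfolding Q_function_def signed_kernel_def by blast

lemma q_total: "x \<in> S \<Longrightarrow> 0 \<le> s \<Longrightarrow> q x s S = 0"
  using Q unfolding Q_function_def by blast

lemma q_nonneg: "x \<in> S \<Longrightarrow> 0 \<le> s \<Longrightarrow> A \<in> sets (borel_on S) \<Longrightarrow> x \<notin> A \<Longrightarrow> 0 \<le> q x s A"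
  using Q unfolding Q_function_def by blast

lemma q_measurable: "A \<in> sets (borel_on S) \<Longrightarrow>
    (\<lambda>(x, s). q x s A) \<in> borel_measurable (borel_on S \<Otimes>\<^sub>M borel_on {0..})"
  using Q unfolding Q_function_def signed_kernel_def by blast

lemma q_Un:
  assumes "x \<in> S" "0 \<le> s" "A \<in> sets (borel_on S)" "B \<in> sets (borel_on S)" "A \<inter> B = {}"
  shows "q x s (A \<union> B) = q x s A + q x s B"
proof -
  have "(\<lambda>n. q x s (binaryset A B n)) sums q x s (\<Union>n. binaryset A B n)"
    using assms by (intro q_sums)
      (auto simp: range_binaryset_eq disjoint_family_on_def binaryset_def)
  moreover have "(\<lambda>n. q x s (binaryset A B n)) sums (q x s A + q x s B)"
    using assms by (intro binaryset_sums q_empty)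
  ultimately show ?thesis
    using sums_unique2 by (fastforce simp: UN_binaryset_eq)
qed

lemma q_Diff:
  assumes "x \<in> S" "0 \<le> s" "A \<in> sets (borel_on S)"
  shows "q x s (S - A) = - q x s A"
  using q_Un[OF assms(1-3), of "S - A"] q_total[OF assms(1,2)] assms borel_on_into[OF assms(3)]
  by (simp add: Un_absorb1 sets.Diff)

lemma q_rate_eq: "x \<in> S \<Longrightarrow> 0 \<le> s \<Longrightarrow> q_rate q x s = q x s (S - {x})"
  by (simp add: q_rate_def q_Diff)

text \<open>In \<open>q x s (A - {x})\<close> the set moves with \<open>x\<close>, so measurability
  for a fixed set does not suffice. A Dynkin-class argument lifts it from rectangles to all
  sections: total mass zero turns complements into a change of sign, and sigma-additivity handles
  disjoint unions.\<close>

lemma q_section_measurable: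
  assumes "H \<in> sets (borel_on S \<Otimes>\<^sub>M borel_on S)"
  shows "(\<lambda>(x, s). q x s (Pair x -` H)) \<in> borel_measurable (borel_on S \<Otimes>\<^sub>M borel_on {0..})"
  using Int_stable_pair_measure_generator pair_measure_closed assms
  unfolding sets_pair_measure
proof (induct rule: sigma_sets_induct_disjoint)
  case (basic H)
  then obtain A B where H: "H = A \<times> B" and [measurable]: "A \<in> sets (borel_on S)" "B \<in> sets (borel_on S)"
    by auto
  note q_measurable[of B, measurable]
  have "(\<lambda>p. if fst p \<in> A then (case p of (x, s) \<Rightarrow> q x s B) else 0)
      \<in> borel_measurable (borel_on S \<Otimes>\<^sub>M borel_on {0..})"
    by measurable
  then show ?case
    by (rule measurable_cong[THEN iffD1, rotated])
      (auto simp: H space_pair_measure q_empty)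
next
  case empty
  show ?case
    by (rule measurable_cong[THEN iffD1, OF _ measurable_const[of 0]])
      (auto simp: space_pair_measure q_empty)
next
  case (compl H)
  then have H: "H \<in> sets (borel_on S \<Otimes>\<^sub>M borel_on S)" by (simp add: sets_pair_measure)
  have "Pair x -` (space (borel_on S) \<times> space (borel_on S) - H) = S - Pair x -` H" if "x \<in> S" for x
    using that by auto
  moreover have "Pair x -` H \<in> sets (borel_on S)" for x
    using H by (rule sets_Pair1)
  ultimately show ?case
    by (intro measurable_cong[THEN iffD1, OF _ borel_measurable_uminus[OF compl(2)]])
      (auto simp: space_pair_measure q_Diff)
next
  case (union H)
  then have H: "H i \<in> sets (borel_on S \<Otimes>\<^sub>M borel_on S)" for i by (auto simp: sets_pair_measure)
  have "(\<lambda>i. q x s (Pair x -` H i)) sums q x s (Pair x -` (\<Union>i. H i))" if "x \<in> S" "0 \<le> s" for x s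
    unfolding vimage_UN using that union(1) H
    by (intro q_sums) (auto intro!: sets_Pair1 simp: disjoint_family_on_def)
  then have "q x s (Pair x -` (\<Union>i. H i)) = (\<Sum>i. q x s (Pair x -` H i))" if "x \<in> S" "0 \<le> s" for x s
    using that by (simp add: sums_iff)
  then show ?case
    by (intro measurable_cong[THEN iffD1, OF _ borel_measurable_suminf[OF union(3)]])
      (auto simp: space_pair_measure)
qed

text \<open>\<open>A - {x}\<close> is the section at \<open>x\<close> of \<open>S \<times> A\<close>
  with the diagonal removed, and the diagonal is measurable in the product.\<close>

lemma q_Diff_singleton_measurable:
  assumes [measurable]: "A \<in> sets (borel_on S)"
  shows "(\<lambda>(x, s). q x s (A - {x})) \<in> borel_measurable (borel_on S \<Otimes>\<^sub>M borel_on {0..})"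
proof -
  have [measurable]: "fst \<in> borel_measurable (borel_on S \<Otimes>\<^sub>M borel_on S)"
    "snd \<in> borel_measurable (borel_on S \<Otimes>\<^sub>M borel_on S)"
    by (auto intro!: measurable_compose[OF measurable_fst] measurable_compose[OF measurable_snd]
        measurable_restrict_space1)
  have "{p \<in> space (borel_on S \<Otimes>\<^sub>M borel_on S). fst p = snd p} \<in> sets (borel_on S \<Otimes>\<^sub>M borel_on S)"
    by (rule measurable_equality_set) auto
  then have "S \<times> A - {p \<in> space (borel_on S \<Otimes>\<^sub>M borel_on S). fst p = snd p}
      \<in> sets (borel_on S \<Otimes>\<^sub>M borel_on S)"
    by (intro sets.Diff pair_measureI) auto
  from q_section_measurable[OF this] show ?thesis
    by (rule measurable_cong[THEN iffD1, rotated])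
      (use borel_on_into[OF assms] in \<open>auto simp: space_pair_measure intro!: arg_cong[where f="q _ _"]\<close>)
qed

section \<open>The measures \<open>q_tilde\<close> and their measurable dependence on state and
  time\<close>

lemma sets_q_tilde [simp, measurable_cong]: "sets (q_tilde S q x s) = sets (borel_on S)"
  unfolding q_tilde_def using sets.sigma_sets_eq[of "borel_on S"] sets.space_closed[of "borel_on S"]
  by simp

lemma space_q_tilde [simp]: "space (q_tilde S q x s) = S"
  using sets_eq_imp_space_eq[OF sets_q_tilde] by simp

text \<open>Away from \<open>x\<close> the signed measure is nonnegative, so \<open>ennreal\<close>
  truncates nothing and sigma-additivity carries over from \<open>q\<close>.\<close>

lemma emeasure_q_tilde:
  assumes "x \<in> S" "0 \<le> s" "A \<in> sets (borel_on S)"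
  shows "emeasure (q_tilde S q x s) A = ennreal (q x s (A - {x}))"
  unfolding q_tilde_def
proof (rule emeasure_measure_of_sigma)
  show "sigma_algebra S (sets (borel_on S))"
    using sets.sigma_algebra_axioms[of "borel_on S"] by simp
  show "positive (sets (borel_on S)) (\<lambda>A. ennreal (q x s (A - {x})))"
    using assms by (simp add: positive_def q_empty)
  show "countably_additive (sets (borel_on S)) (\<lambda>A. ennreal (q x s (A - {x})))"
  proof (rule countably_additiveI)
    fix A :: "nat \<Rightarrow> 'a set" assume A: "range A \<subseteq> sets (borel_on S)" "disjoint_family A"
    have "(\<lambda>i. q x s (A i - {x})) sums q x s (\<Union>i. A i - {x})"
      using A assms by (intro q_sums) (auto simp: disjoint_family_on_def)
    moreover have "0 \<le> q x s (A i - {x})" for i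
      using A assms by (intro q_nonneg) auto
    ultimately show "(\<Sum>i. ennreal (q x s (A i - {x}))) = ennreal (q x s ((\<Union>i. A i) - {x}))"
      by (subst suminf_ennreal_eq) auto
  qed
qed fact

text \<open>Only times \<open>s \<ge> 0\<close> are meaningful; clamping at \<open>0\<close> makes rates and kernels total in time.\<close>

definition rate :: "'a \<Rightarrow> real \<Rightarrow> real" where
  "rate x u = q_rate q x (max 0 u)"

definition kern :: "'a \<Rightarrow> real \<Rightarrow> 'a measure" where
  "kern x u = q_tilde S q x (max 0 u)"

lemma rate_eq: "0 \<le> u \<Longrightarrow> rate x u = q_rate q x u"
  and kern_eq: "0 \<le> u \<Longrightarrow> kern x u = q_tilde S q x u"
  by (simp_all add: rate_def kern_def)

lemma sets_kern [simp, measurable_cong]: "sets (kern x u) = sets (borel_on S)"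
  and space_kern [simp]: "space (kern x u) = S"
  by (simp_all add: kern_def)

lemma rate_nonneg: "x \<in> S \<Longrightarrow> 0 \<le> rate x u"
  by (auto simp: rate_def q_rate_eq intro!: q_nonneg)

lemma rate_bounded:
  assumes "x \<in> S" obtains M where "\<And>u. rate x u \<le> M"
proof -
  obtain M where "\<And>s. 0 \<le> s \<Longrightarrow> q x s (S - {x}) \<le> M"
    using Q assms unfolding Q_function_def bdd_above_def by fastforce
  with assms have "rate x u \<le> M" for u by (auto simp: rate_def q_rate_eq)
  then show thesis by (rule that)
qed

lemma clamp_measurable:
  "(\<lambda>(x, u). (x, max 0 u)) \<in> borel_on S \<Otimes>\<^sub>M borel \<rightarrow>\<^sub>M borel_on S \<Otimes>\<^sub>M borel_on {0::real..}"
  unfolding split_beta'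
  by (intro measurable_Pair measurable_fst measurable_restrict_space2) (auto intro: borel_measurable_max)

lemma rate_measurable [measurable (raw)]:
  assumes [measurable]: "X \<in> M \<rightarrow>\<^sub>M borel_on S" "T \<in> borel_measurable M"
  shows "(\<lambda>z. rate (X z) (T z)) \<in> borel_measurable M"
proof -
  have "(\<lambda>(x, s). q_rate q x s) \<in> borel_measurable (borel_on S \<Otimes>\<^sub>M borel_on {0..})"
    using q_Diff_singleton_measurable[of S]
    by (rule measurable_cong[THEN iffD1, rotated]) (auto simp: space_pair_measure q_rate_eq)
  from measurable_compose[OF clamp_measurable this]
  have [measurable]: "(\<lambda>(x, u). rate x u) \<in> borel_measurable (borel_on S \<Otimes>\<^sub>M borel)"
    by (simp add: rate_def split_beta')
  have "(\<lambda>z. (X z, T z)) \<in> M \<rightarrow>\<^sub>M borel_on S \<Otimes>\<^sub>M borel" by measurable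
  from measurable_compose[OF this, of "\<lambda>(x, u). rate x u"] show ?thesis by simp
qed

lemma emeasure_kern:
  "x \<in> S \<Longrightarrow> A \<in> sets (borel_on S) \<Longrightarrow> emeasure (kern x u) A = ennreal (q x (max 0 u) (A - {x}))"
  by (simp add: kern_def emeasure_q_tilde)

lemma emeasure_kern_space: "x \<in> S \<Longrightarrow> emeasure (kern x u) S = ennreal (rate x u)"
  by (simp add: emeasure_kern rate_def q_rate_eq)

lemma emeasure_kern_measurable:
  assumes "A \<in> sets (borel_on S)"
  shows "(\<lambda>(x, u). emeasure (kern x u) A) \<in> borel_measurable (borel_on S \<Otimes>\<^sub>M borel)"
proof -
  have "(\<lambda>p. ennreal ((\<lambda>(x, s). q x s (A - {x})) ((\<lambda>(x, u). (x, max 0 u)) p)))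
      \<in> borel_measurable (borel_on S \<Otimes>\<^sub>M borel)"
    by (intro measurable_compose[OF measurable_compose[OF clamp_measurable
      q_Diff_singleton_measurable[OF assms]] measurable_ennreal])
  then show ?thesis
    by (rule measurable_cong[THEN iffD1, rotated])
      (auto simp: space_pair_measure emeasure_kern assms)
qed

text \<open>The kernel has unbounded mass; dividing by \<open>1 + rate\<close> makes the library on
  sub-probability kernels applicable.\<close>

lemma nn_integral_kern_measurable [measurable (raw)]:
  assumes f: "(\<lambda>(z, y). f z y) \<in> borel_measurable (M \<Otimes>\<^sub>M borel_on S)"
    and X: "X \<in> M \<rightarrow>\<^sub>M borel_on S" and T: "T \<in> borel_measurable M"
  shows "(\<lambda>z. \<integral>\<^sup>+y. f z y \<partial>kern (X z) (T z)) \<in> borel_measurable M"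
proof -
  note [measurable] = X T
  define K where "K = (\<lambda>(x, u). scale_measure (ennreal (1 / (1 + rate x u))) (kern x u))"
  have "K \<in> borel_on S \<Otimes>\<^sub>M borel \<rightarrow>\<^sub>M subprob_algebra (borel_on S)"
  proof (rule measurable_subprob_algebra)
    fix p assume "p \<in> space (borel_on S \<Otimes>\<^sub>M (borel :: real measure))"
    then have x: "fst p \<in> S" by (auto simp: space_pair_measure)
    have "emeasure (K p) (space (K p)) = ennreal (1 / (1 + rate (fst p) (snd p)) * rate (fst p) (snd p))"
      using x rate_nonneg[OF x]
      by (simp add: K_def split_beta' space_scale_measure emeasure_kern_space flip: ennreal_mult)
    also have "\<dots> \<le> 1"
      using rate_nonneg[OF x, of "snd p"] by (simp add: divide_simps)
    finally show "subprob_space (K p)"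
      using S_nonempty by (intro subprob_spaceI) (auto simp: K_def split_beta' space_scale_measure)
    show "sets (K p) = sets (borel_on S)" by (simp add: K_def split_beta')
  next
    fix A assume A: "A \<in> sets (borel_on S)"
    note emeasure_kern_measurable[OF A, measurable]
    show "(\<lambda>p. emeasure (K p) A) \<in> borel_measurable (borel_on S \<Otimes>\<^sub>M borel)"
      unfolding K_def split_beta' emeasure_scale_measure
      using emeasure_kern_measurable[OF A] by (simp add: split_beta')
  qed
  moreover have "(\<lambda>z. (X z, T z)) \<in> M \<rightarrow>\<^sub>M borel_on S \<Otimes>\<^sub>M borel" by measurable
  ultimately have "(\<lambda>z. K (X z, T z)) \<in> M \<rightarrow>\<^sub>M subprob_algebra (borel_on S)"
    by (rule measurable_compose[rotated])
  from nn_integral_measurable_subprob_algebra2[OF f this]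
  have "(\<lambda>z. ennreal (1 + rate (X z) (T z)) * (\<integral>\<^sup>+y. f z y \<partial>K (X z, T z))) \<in> borel_measurable M"
    by measurable
  then show ?thesis
  proof (rule measurable_cong[THEN iffD1, rotated])
    fix z assume z: "z \<in> space M"
    then have x: "X z \<in> S" using measurable_space[OF X] by simp
    have "f z \<in> borel_measurable (borel_on S)"
      using measurable_Pair2[OF f z] by simp
    then have "f z \<in> borel_measurable (kern (X z) (T z))"
      by (simp cong: measurable_cong_sets)
    moreover have "ennreal (1 + rate (X z) (T z)) * ennreal (1 / (1 + rate (X z) (T z))) = 1"
      using rate_nonneg[OF x, of "T z"] by (simp flip: ennreal_mult del: ennreal_plus)
    ultimately show "ennreal (1 + rate (X z) (T z)) * (\<integral>\<^sup>+y. f z y \<partial>K (X z, T z))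
        = (\<integral>\<^sup>+y. f z y \<partial>kern (X z) (T z))"
      by (simp add: K_def nn_integral_scale_measure mult.assoc[symmetric] del: ennreal_plus)
  qed
qed

end

section \<open>The law of the next jump\<close>

text \<open>The infimum of a decreasing sequence is its limit, and multiplication by a finite
  constant is continuous on \<open>ennreal\<close>.\<close>

lemma ennreal_mult_INF_decseq:
  fixes f :: "nat \<Rightarrow> ennreal"
  assumes "decseq f" "c < top"
  shows "c * (INF i. f i) = (INF i. c * f i)"
proof (rule LIMSEQ_unique)
  show "(\<lambda>i. c * f i) \<longlonglongrightarrow> c * (INF i. f i)"
    using assms by (intro ennreal_tendsto_cmult LIMSEQ_INF)
  show "(\<lambda>i. c * f i) \<longlonglongrightarrow> (INF i. c * f i)"
    using assms by (intro LIMSEQ_INF) (auto simp: decseq_def intro!: mult_left_mono)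
qed

section \<open>Measurability on the state space with a cemetery point\<close>

lemma sets_cemetery_spaceI:
  "A \<subseteq> insert None (Some ` S) \<Longrightarrow> Some -` A \<in> sets (borel_on S) \<Longrightarrow> A \<in> sets (cemetery_space S)"
  unfolding cemetery_space_def by (subst sets_measure_of) (auto intro: sigma_sets.Basic)

lemma space_cemetery_space [simp]: "space (cemetery_space S) = insert None (Some ` S)"
  unfolding cemetery_space_def by (rule space_measure_of) auto

lemma space_jump_space: "space (jump_space S) = UNIV \<times> insert None (Some ` S)"
  by (simp add: jump_space_def space_pair_measure)

lemma Some_measurable [measurable]: "Some \<in> borel_on S \<rightarrow>\<^sub>M cemetery_space S"
  unfolding cemetery_space_def
  by (rule measurable_measure_of) (auto intro!: sets.Int sets.top[of "borel_on S", simplified])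

lemma None_measurable [measurable]: "Measurable.pred (cemetery_space S) (\<lambda>z. z = None)"
proof -
  have "{z \<in> space (cemetery_space S). z = None} \<in> sets (cemetery_space S)"
    by (rule sets_cemetery_spaceI) auto
  then show ?thesis by (simp add: pred_def)
qed

text \<open>Sending the cemetery to an arbitrary point of \<open>S\<close> gives a total measurable
  map \<open>r\<close> back to \<open>S\<close>; the case distinction is then a conditional on the
  measurable event \<open>Z z = None\<close>.\<close>

lemma measurable_case_cemetery [measurable (raw)]:
  assumes [measurable]: "(\<lambda>(z, x). f z x) \<in> M \<Otimes>\<^sub>M borel_on S \<rightarrow>\<^sub>M N" "g \<in> M \<rightarrow>\<^sub>M N"
    "Z \<in> M \<rightarrow>\<^sub>M cemetery_space S" and ne: "S \<noteq> {}"
  shows "(\<lambda>z. case Z z of None \<Rightarrow> g z | Some x \<Rightarrow> f z x) \<in> M \<rightarrow>\<^sub>M N"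
proof -
  obtain x0 where x0: "x0 \<in> S" using ne by auto
  define r where "r z = (case z of None \<Rightarrow> x0 | Some x \<Rightarrow> x)" for z
  have [measurable]: "r \<in> cemetery_space S \<rightarrow>\<^sub>M borel_on S"
  proof (rule measurableI)
    show "r z \<in> space (borel_on S)" if "z \<in> space (cemetery_space S)" for z
      using that x0 by (auto simp: r_def)
    fix B assume B: "B \<in> sets (borel_on S)"
    then have "B \<subseteq> S" using sets.sets_into_space by fastforce
    then have "Some -` (r -` B \<inter> space (cemetery_space S)) = B"
      by (auto simp: r_def)
    with B show "r -` B \<inter> space (cemetery_space S) \<in> sets (cemetery_space S)"
      by (intro sets_cemetery_spaceI) auto
  qed
  have "(\<lambda>z. if Z z = None then g z else (\<lambda>(z, x). f z x) (z, r (Z z))) \<in> M \<rightarrow>\<^sub>M N"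
    by measurable
  also have "(\<lambda>z. if Z z = None then g z else (\<lambda>(z, x). f z x) (z, r (Z z)))
      = (\<lambda>z. case Z z of None \<Rightarrow> g z | Some x \<Rightarrow> f z x)"
    by (auto simp: r_def split: option.split)
  finally show ?thesis .
qed

section \<open>Integration against the density of the next jump\<close>

context Q_process
begin

text \<open>The expectation of \<open>g\<close> at the next jump moment and post-jump state,
  restricted to the event that this jump occurs, for a process that sits in \<open>x\<close> at time
  \<open>t\<close>.\<close>

definition jump_int :: "real \<Rightarrow> 'a \<Rightarrow> (real \<Rightarrow> 'a \<Rightarrow> ennreal) \<Rightarrow> ennreal" where
  "jump_int t x g = (\<integral>\<^sup>+u. ennreal (exp (- (LBINT w:{t..u}. rate x w))) *
     (\<integral>\<^sup>+y. g u y \<partial>kern x u) * indicator {t<..} u \<partial>lborel)"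

lemma survival_measurable [measurable (raw)]:
  assumes [measurable]: "X \<in> M \<rightarrow>\<^sub>M borel_on S" "T \<in> borel_measurable M" "V \<in> borel_measurable M"
  shows "(\<lambda>z. LBINT w:{T z..V z}. rate (X z) w) \<in> borel_measurable M"
proof -
  have "(\<lambda>p. rate (X (fst p)) (snd p)) \<in> borel_measurable (M \<Otimes>\<^sub>M lborel)"
    by measurable
  from borel_measurable_set_integral_param[OF this assms(2,3)] show ?thesis by simp
qed

lemma jump_int_measurable [measurable (raw)]:
  assumes [measurable]: "X \<in> M \<rightarrow>\<^sub>M borel_on S" "T \<in> borel_measurable M"
    and g: "(\<lambda>((z, u), y). g z u y) \<in> borel_measurable ((M \<Otimes>\<^sub>M borel) \<Otimes>\<^sub>M borel_on S)"
  shows "(\<lambda>z. jump_int (T z) (X z) (g z)) \<in> borel_measurable M"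
proof -
  have g': "(\<lambda>(p, y). g (fst p) (snd p) y) \<in> borel_measurable ((M \<Otimes>\<^sub>M borel) \<Otimes>\<^sub>M borel_on S)"
    using g by (simp add: split_beta')
  have [measurable]: "(\<lambda>p. \<integral>\<^sup>+y. g (fst p) (snd p) y \<partial>kern (X (fst p)) (snd p))
      \<in> borel_measurable (M \<Otimes>\<^sub>M borel)"
    by (rule nn_integral_kern_measurable[OF g']) measurable
  have ind: "indicator {T (fst p)<..} (snd p) = (if T (fst p) < snd p then 1 else 0 :: ennreal)" for p :: "_ \<times> real"
    by (auto split: split_indicator)
  have "(\<lambda>p. ennreal (exp (- (LBINT w:{T (fst p)..snd p}. rate (X (fst p)) w))) *
     (\<integral>\<^sup>+y. g (fst p) (snd p) y \<partial>kern (X (fst p)) (snd p)) * indicator {T (fst p)<..} (snd p))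
     \<in> borel_measurable (M \<Otimes>\<^sub>M borel)"
    unfolding ind by measurable
  also have "borel_measurable (M \<Otimes>\<^sub>M borel) = borel_measurable (M \<Otimes>\<^sub>M (lborel :: real measure))"
    by (intro measurable_cong_sets sets_pair_measure_cong) auto
  finally show ?thesis
    unfolding jump_int_def
    by (intro lborel.borel_measurable_nn_integral) (simp add: split_beta')
qed

context
  fixes t :: real and x assumes x: "x \<in> S"
begin

lemma kern_int_measurable [measurable]:
  assumes "(\<lambda>(u, y). g u y) \<in> borel_measurable (borel \<Otimes>\<^sub>M borel_on S)"
  shows "(\<lambda>u. \<integral>\<^sup>+y. g u y \<partial>kern x u) \<in> borel_measurable borel"
  by (rule nn_integral_kern_measurable[OF assms]) (use x in auto)

lemma kern_fun_measurable:
  assumes "(\<lambda>(u, y). g u y) \<in> borel_measurable (borel \<Otimes>\<^sub>M borel_on S)"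
  shows "g u \<in> borel_measurable (kern x u)"
  using measurable_Pair2[OF assms, of u] by (simp cong: measurable_cong_sets)

lemma survival_measurable1 [measurable]: "(\<lambda>u. LBINT w:{t..u}. rate x w) \<in> borel_measurable borel"
  by (rule survival_measurable) (use x in auto)

text \<open>The total mass of \<open>kern x u\<close> is \<open>rate x u\<close>, so the integrand
  is the hazard density of the waiting time.\<close>

lemma jump_int_one_le_1: "jump_int t x (\<lambda>_ _. 1) \<le> 1"
proof -
  obtain M where M: "\<And>u. rate x u \<le> M" using rate_bounded[OF x] by blast
  have "jump_int t x (\<lambda>_ _. 1) =
    (\<integral>\<^sup>+u. ennreal (rate x u * exp (- (LBINT w:{t..u}. rate x w))) * indicator {t<..} u \<partial>lborel)"
    unfolding jump_int_def
    by (intro nn_integral_cong) (simp add: emeasure_kern_space x ennreal_mult' mult.commute rate_nonneg)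
  also have "\<dots> \<le> 1"
    by (rule nn_integral_hazard_rate_le_1) (use x M rate_nonneg in auto)
  finally show ?thesis .
qed

lemma jump_int_mono:
  assumes "\<And>u y. t < u \<Longrightarrow> y \<in> S \<Longrightarrow> g u y \<le> h u y"
  shows "jump_int t x g \<le> jump_int t x h"
  unfolding jump_int_def using assms
  by (intro nn_integral_mono) (auto intro!: mult_left_mono nn_integral_mono split: split_indicator)

lemma jump_int_cong:
  assumes "\<And>u y. t < u \<Longrightarrow> y \<in> S \<Longrightarrow> g u y = h u y"
  shows "jump_int t x g = jump_int t x h"
  by (intro antisym jump_int_mono) (simp_all add: assms)

lemma jump_int_cmult:
  assumes [measurable]: "(\<lambda>(u, y). g u y) \<in> borel_measurable (borel \<Otimes>\<^sub>M borel_on S)"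
  shows "jump_int t x (\<lambda>u y. c * g u y) = c * jump_int t x g"
  unfolding jump_int_def
  by (subst nn_integral_cmult[symmetric], measurable)
    (auto intro!: nn_integral_cong simp: nn_integral_cmult kern_fun_measurable mult_ac)

lemma jump_int_add:
  assumes [measurable]: "(\<lambda>(u, y). g u y) \<in> borel_measurable (borel \<Otimes>\<^sub>M borel_on S)"
    "(\<lambda>(u, y). h u y) \<in> borel_measurable (borel \<Otimes>\<^sub>M borel_on S)"
  shows "jump_int t x (\<lambda>u y. g u y + h u y) = jump_int t x g + jump_int t x h"
  unfolding jump_int_def
  by (subst nn_integral_add[symmetric], measurable)
    (auto intro!: nn_integral_cong simp: nn_integral_add kern_fun_measurable algebra_simps)

lemma jump_int_SUP:
  assumes [measurable]: "\<And>i::nat. (\<lambda>(u, y). g i u y) \<in> borel_measurable (borel \<Otimes>\<^sub>M borel_on S)"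
    and inc: "\<And>u y. incseq (\<lambda>i. g i u y)"
  shows "jump_int t x (\<lambda>u y. SUP i. g i u y) = (SUP i. jump_int t x (g i))"
proof -
  have *: "(\<integral>\<^sup>+y. (SUP i. g i u y) \<partial>kern x u) = (SUP i. \<integral>\<^sup>+y. g i u y \<partial>kern x u)" for u
    using inc by (intro nn_integral_monotone_convergence_SUP kern_fun_measurable assms(1))
      (auto simp: incseq_def le_fun_def)
  show ?thesis
    unfolding jump_int_def *
  proof (subst nn_integral_monotone_convergence_SUP[where M=lborel and f="\<lambda>i u.
      ennreal (exp (- (LBINT w:{t..u}. rate x w))) * (\<integral>\<^sup>+y. g i u y \<partial>kern x u) * indicator {t<..} u",
      symmetric])
    show "incseq (\<lambda>i u. ennreal (exp (- (LBINT w:{t..u}. rate x w))) *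
        (\<integral>\<^sup>+y. g i u y \<partial>kern x u) * indicator {t<..} u)"
      using inc by (auto simp: incseq_def le_fun_def intro!: mult_right_mono mult_left_mono nn_integral_mono)
  qed (auto intro!: nn_integral_cong simp: SUP_mult_left_ennreal SUP_mult_right_ennreal)
qed

lemma jump_int_suminf:
  assumes [measurable]: "\<And>i::nat. (\<lambda>(u, y). g i u y) \<in> borel_measurable (borel \<Otimes>\<^sub>M borel_on S)"
  shows "jump_int t x (\<lambda>u y. \<Sum>i. g i u y) = (\<Sum>i. jump_int t x (g i))"
  unfolding jump_int_def
  by (subst nn_integral_suminf[symmetric], measurable)
    (auto intro!: nn_integral_cong simp: nn_integral_suminf kern_fun_measurable assms)

text \<open>Decreasing monotone convergence is applied to the inner and then to the outer integral.
  The bound 1 on \<open>g\<close> supplies the finite starting integral both times: at most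
  \<open>rate x u\<close> inside and at most 1 outside.\<close>

lemma jump_int_INF:
  assumes [measurable]: "\<And>i::nat. (\<lambda>(u, y). g i u y) \<in> borel_measurable (borel \<Otimes>\<^sub>M borel_on S)"
    and dec: "\<And>u y. decseq (\<lambda>i. g i u y)" and le1: "\<And>i u y. g i u y \<le> 1"
  shows "jump_int t x (\<lambda>u y. INF i. g i u y) = (INF i. jump_int t x (g i))"
proof -
  have *: "(\<integral>\<^sup>+y. (INF i. g i u y) \<partial>kern x u) = (INF i. \<integral>\<^sup>+y. g i u y \<partial>kern x u)" for u
  proof (rule nn_integral_monotone_convergence_INF_decseq[where i=0])
    have "(\<integral>\<^sup>+y. g 0 u y \<partial>kern x u) \<le> (\<integral>\<^sup>+y. 1 \<partial>kern x u)"
      by (intro nn_integral_mono le1)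
    also have "\<dots> < \<infinity>" by (simp add: emeasure_kern_space x)
    finally show "(\<integral>\<^sup>+y. g 0 u y \<partial>kern x u) < \<infinity>" .
  qed (use dec in \<open>auto simp: monotone_def le_fun_def intro!: kern_fun_measurable\<close>)
  have cINF: "a * (INF i. \<integral>\<^sup>+y. g i u y \<partial>kern x u) * b = (INF i. a * (\<integral>\<^sup>+y. g i u y \<partial>kern x u) * b)"
    if "a < top" "b < top" for a b u
  proof -
    have "decseq (\<lambda>i. \<integral>\<^sup>+y. g i u y \<partial>kern x u)"
      using dec by (auto simp: decseq_def le_fun_def intro!: nn_integral_mono)
    from ennreal_mult_INF_decseq[OF this, of "a * b"] that show ?thesis
      by (simp add: ennreal_mult_less_top mult_ac)
  qed
  show ?thesis
    unfolding jump_int_def *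
  proof (subst nn_integral_monotone_convergence_INF_decseq[where i=0 and M=lborel and f="\<lambda>i u.
      ennreal (exp (- (LBINT w:{t..u}. rate x w))) * (\<integral>\<^sup>+y. g i u y \<partial>kern x u) * indicator {t<..} u",
      symmetric])
    show "decseq (\<lambda>i u. ennreal (exp (- (LBINT w:{t..u}. rate x w))) *
        (\<integral>\<^sup>+y. g i u y \<partial>kern x u) * indicator {t<..} u)"
      using dec by (auto simp: monotone_def le_fun_def intro!: mult_right_mono mult_left_mono nn_integral_mono)
    have "jump_int t x (g 0) \<le> jump_int t x (\<lambda>_ _. 1)" by (intro jump_int_mono le1)
    also have "\<dots> \<le> 1" by (rule jump_int_one_le_1)
    also have "1 < (\<infinity> :: ennreal)" by simp
    finally show "(\<integral>\<^sup>+u. ennreal (exp (- (LBINT w:{t..u}. rate x w))) *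
        (\<integral>\<^sup>+y. g 0 u y \<partial>kern x u) * indicator {t<..} u \<partial>lborel) < \<infinity>"
      by (simp add: jump_int_def)
  qed (auto intro!: nn_integral_cong cINF split: split_indicator)
qed

end

section \<open>From the density to the transition kernel of the jump chain\<close>

lemma jump_space_section_measurable [measurable]:
  assumes "f \<in> borel_measurable (jump_space S)"
  shows "(\<lambda>(u, y). f (ennreal u, Some y)) \<in> borel_measurable (borel \<Otimes>\<^sub>M borel_on S)"
proof -
  have "(\<lambda>p. (ennreal (fst p), Some (snd p))) \<in> borel \<Otimes>\<^sub>M borel_on S \<rightarrow>\<^sub>M jump_space S"
    unfolding jump_space_def by measurable
  from measurable_compose[OF this assms] show ?thesis by (simp add: split_beta')
qed

lemma jump_mass_eq:
  assumes "0 \<le> t" "x \<in> S"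
  shows "jump_mass S q t x B = jump_int t x (\<lambda>u y. indicator B (ennreal u, Some y))"
proof -
  have "(LBINT w:{t..u}. q_rate q x w) = (LBINT w:{t..u}. rate x w)" for u
    using assms by (intro set_lebesgue_integral_cong) (auto simp: rate_eq)
  then show ?thesis
    unfolding jump_mass_def jump_int_def using assms
    by (intro nn_integral_cong) (auto simp: kern_eq split: split_indicator)
qed

lemma jump_int_space:
  assumes "x \<in> S"
  shows "jump_int t x (\<lambda>u y. indicator (space (jump_space S)) (ennreal u, Some y)) = jump_int t x (\<lambda>_ _. 1)"
  using assms by (auto simp: space_jump_space intro!: jump_int_cong)

lemma sets_jump_law [simp, measurable_cong]: "sets (jump_law S q t x) = sets (jump_space S)"
  and space_jump_law [simp]: "space (jump_law S q t x) = space (jump_space S)"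
  unfolding jump_law_def using sets.sigma_sets_eq[of "jump_space S"] sets.space_closed[of "jump_space S"]
  by simp_all

text \<open>The formula defining \<open>jump_law\<close> has to be shown to be a measure. For a
  disjoint union the indicators add up pointwise, and the series passes through
  \<open>jump_int\<close>.\<close>

lemma emeasure_jump_law:
  assumes "0 \<le> t" "x \<in> S" and B: "B \<in> sets (jump_space S)"
  shows "emeasure (jump_law S q t x) B =
    jump_int t x (\<lambda>u y. indicator B (ennreal u, Some y))
    + (1 - jump_int t x (\<lambda>_ _. 1)) * indicator B (\<infinity>, None)"
proof -
  let ?\<mu> = "\<lambda>B. jump_int t x (\<lambda>u y. indicator B (ennreal u, Some y))
    + (1 - jump_int t x (\<lambda>_ _. 1)) * indicator B (\<infinity>, None)"
  have "emeasure (jump_law S q t x) B = ?\<mu> B"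
    unfolding jump_law_def jump_mass_eq[OF assms(1,2)] jump_int_space[OF assms(2)]
  proof (rule emeasure_measure_of_sigma)
    show "sigma_algebra (space (jump_space S)) (sets (jump_space S))"
      by (rule sets.sigma_algebra_axioms)
    show "positive (sets (jump_space S)) ?\<mu>"
      by (simp add: positive_def jump_int_def)
    show "countably_additive (sets (jump_space S)) ?\<mu>"
    proof (rule countably_additiveI)
      fix A :: "nat \<Rightarrow> (ennreal \<times> 'a option) set"
      assume A: "range A \<subseteq> sets (jump_space S)" "disjoint_family A"
      have ind: "indicator (\<Union>i. A i) p = (\<Sum>i. indicator (A i) p :: ennreal)" for p
        using A(2) by (rule suminf_indicator[symmetric])
      have "(\<Sum>i. ?\<mu> (A i)) = (\<Sum>i. jump_int t x (\<lambda>u y. indicator (A i) (ennreal u, Some y)))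
          + (\<Sum>i. (1 - jump_int t x (\<lambda>_ _. 1)) * indicator (A i) (\<infinity>, None))"
        by (rule suminf_add[symmetric]) auto
      also have "\<dots> = ?\<mu> (\<Union>i. A i)"
        unfolding ind using A assms
        by (subst jump_int_suminf) (auto intro!: jump_space_section_measurable borel_measurable_indicator)
      finally show "(\<Sum>i. ?\<mu> (A i)) = ?\<mu> (\<Union>i. A i)" .
    qed
  qed (rule B)
  then show ?thesis .
qed

text \<open>The atom at \<open>(\<infinity>, None)\<close> restores total mass 1. Subtraction in
  \<open>ennreal\<close> is truncated, so this rests on the jump part having mass at most 1.\<close>

lemma prob_space_jump_law:
  assumes "0 \<le> t" "x \<in> S"
  shows "prob_space (jump_law S q t x)"
proof (rule prob_spaceI)
  have "(\<infinity>, None) \<in> space (jump_space S)" by (simp add: space_jump_space)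
  then show "emeasure (jump_law S q t x) (space (jump_law S q t x)) = 1"
    using jump_int_one_le_1[OF assms(2), of t]
    by (simp add: emeasure_jump_law[OF assms] jump_int_space[OF assms(2)])
qed

lemma nn_integral_jump_law:
  assumes tx: "0 \<le> t" "x \<in> S" and f: "f \<in> borel_measurable (jump_space S)"
  shows "(\<integral>\<^sup>+s. f s \<partial>jump_law S q t x) =
    jump_int t x (\<lambda>u y. f (ennreal u, Some y)) + (1 - jump_int t x (\<lambda>_ _. 1)) * f (\<infinity>, None)"
  using f
proof (induction rule: borel_measurable_induct)
  case (cong f g)
  have "(\<integral>\<^sup>+s. f s \<partial>jump_law S q t x) = (\<integral>\<^sup>+s. g s \<partial>jump_law S q t x)"
    by (intro nn_integral_cong) (simp add: cong)
  moreover have "jump_int t x (\<lambda>u y. f (ennreal u, Some y)) = jump_int t x (\<lambda>u y. g (ennreal u, Some y))"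
    using tx by (intro jump_int_cong) (auto simp: cong space_jump_space)
  ultimately show ?case using cong by (simp add: space_jump_space)
next
  case (set A)
  then show ?case by (simp add: emeasure_jump_law tx)
next
  case (mult f c)
  have "f \<in> borel_measurable (jump_law S q t x)" using mult by (simp cong: measurable_cong_sets)
  then show ?case
    using mult tx by (simp add: nn_integral_cmult jump_int_cmult jump_space_section_measurable
      distrib_left mult_ac)
next
  case (add f g)
  have "f \<in> borel_measurable (jump_law S q t x)" "g \<in> borel_measurable (jump_law S q t x)"
    using add by (simp_all cong: measurable_cong_sets)
  then show ?case
    using add tx by (simp add: nn_integral_add jump_int_add jump_space_section_measurable
      distrib_left add_ac)
next
  case (seq U)
  have U: "U i \<in> borel_measurable (jump_law S q t x)" for i
    using seq by (simp cong: measurable_cong_sets)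
  have inc: "incseq (\<lambda>i. U i s)" for s
    using seq(3) by (cases s) (auto simp: incseq_def le_fun_def)
  have "(\<integral>\<^sup>+s. (SUP i. U i s) \<partial>jump_law S q t x) = (SUP i. \<integral>\<^sup>+s. U i s \<partial>jump_law S q t x)"
    using seq U by (intro nn_integral_monotone_convergence_SUP) auto
  also have "\<dots> = (SUP i. jump_int t x (\<lambda>u y. U i (ennreal u, Some y)) +
      (1 - jump_int t x (\<lambda>_ _. 1)) * U i (\<infinity>, None))"
    using seq by simp
  also have "\<dots> = (SUP i. jump_int t x (\<lambda>u y. U i (ennreal u, Some y))) +
      (SUP i. (1 - jump_int t x (\<lambda>_ _. 1)) * U i (\<infinity>, None))"
    using inc tx
    by (intro ennreal_SUP_add) (auto simp: incseq_def intro!: jump_int_mono mult_left_mono)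
  also have "\<dots> = jump_int t x (\<lambda>u y. SUP i. U i (ennreal u, Some y)) +
      (1 - jump_int t x (\<lambda>_ _. 1)) * (SUP i. U i (\<infinity>, None))"
    using seq inc tx by (subst jump_int_SUP) (auto simp: SUP_mult_left_ennreal jump_space_section_measurable)
  finally show ?case by (simp add: image_comp)
qed

lemma prob_space_next_jump:
  assumes "s \<in> space (jump_space S)" shows "prob_space (next_jump S q s)"
  using assms
  by (auto simp: next_jump_def space_jump_space split: option.split
      intro!: prob_space_jump_law prob_space_return)

lemma sets_next_jump [simp, measurable_cong]: "sets (next_jump S q s) = sets (jump_space S)"
  by (auto simp: next_jump_def split: option.split prod.split)

lemma nn_integral_next_jump:
  assumes f: "f \<in> borel_measurable (jump_space S)" and s: "s \<in> space (jump_space S)"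
  shows "(\<integral>\<^sup>+s'. f s' \<partial>next_jump S q s) =
    (case snd s of None \<Rightarrow> f (\<infinity>, None) | Some x \<Rightarrow>
      if fst s < \<infinity> then jump_int (enn2real (fst s)) x (\<lambda>u y. f (ennreal u, Some y))
        + (1 - jump_int (enn2real (fst s)) x (\<lambda>_ _. 1)) * f (\<infinity>, None)
      else f (\<infinity>, None))"
  using assms
  by (auto simp: next_jump_def space_jump_space nn_integral_jump_law nn_integral_return split: option.split prod.split)

text \<open>Measurability of the transition kernel is what the construction of the trajectory law
  asks for. Integrating the indicator of \<open>A\<close> gives the explicit function
  \<open>F\<close>, whose pieces are parameter integrals of the form
  \<open>jump_int\<close>.\<close>

lemma next_jump_measurable [measurable]:
  "next_jump S q \<in> jump_space S \<rightarrow>\<^sub>M subprob_algebra (jump_space S)"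
proof (rule measurable_subprob_algebra)
  fix A assume [measurable]: "A \<in> sets (jump_space S)"
  define F :: "ennreal \<times> 'a option \<Rightarrow> ennreal" where "F = (\<lambda>s. case snd s of None \<Rightarrow> indicator A (\<infinity>, None) | Some x \<Rightarrow>
      if fst s < \<infinity> then jump_int (enn2real (fst s)) x (\<lambda>u y. indicator A (ennreal u, Some y))
        + (1 - jump_int (enn2real (fst s)) x (\<lambda>_ _. 1)) * indicator A (\<infinity>, None)
      else indicator A (\<infinity>, None))"
  have [measurable]: "fst \<in> borel_measurable (jump_space S)" "snd \<in> jump_space S \<rightarrow>\<^sub>M cemetery_space S"
    by (simp_all add: jump_space_def)
  have sec: "(\<lambda>p. indicator A (ennreal (snd (fst p)), Some (snd p)))
      \<in> borel_measurable ((M \<Otimes>\<^sub>M borel) \<Otimes>\<^sub>M borel_on S)" for M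
  proof -
    have "(\<lambda>p. (ennreal (snd (fst p)), Some (snd p))) \<in> (M \<Otimes>\<^sub>M borel) \<Otimes>\<^sub>M borel_on S \<rightarrow>\<^sub>M jump_space S"
      unfolding jump_space_def by measurable
    then show ?thesis by measurable
  qed
  have [measurable]: "(\<lambda>p. jump_int (enn2real (fst (fst p))) (snd p) (\<lambda>u y. indicator A (ennreal u, Some y)))
      \<in> borel_measurable (jump_space S \<Otimes>\<^sub>M borel_on S)"
    by (rule jump_int_measurable) (use sec in \<open>auto simp: split_beta'\<close>)
  have [measurable]: "(\<lambda>p. jump_int (enn2real (fst (fst p))) (snd p) (\<lambda>u y. 1))
      \<in> borel_measurable (jump_space S \<Otimes>\<^sub>M borel_on S)"
    by (rule jump_int_measurable) (simp_all add: split_beta')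
  have "F \<in> borel_measurable (jump_space S)"
    unfolding F_def by (rule measurable_case_cemetery) (use S_nonempty in \<open>simp_all add: split_beta'\<close>)
  then show "(\<lambda>s. emeasure (next_jump S q s) A) \<in> borel_measurable (jump_space S)"
  proof (rule measurable_cong[THEN iffD1, rotated])
    fix s assume s: "s \<in> space (jump_space S)"
    show "F s = emeasure (next_jump S q s) A"
      using nn_integral_next_jump[OF borel_measurable_indicator s, of A] by (simp add: F_def)
  qed
qed (auto intro: prob_space_imp_subprob_space prob_space_next_jump)

end

section \<open>Trajectories\<close>

context Ionescu_Tulcea
begin

text \<open>The marginal of the limit measure on the first \<open>n\<close> coordinates is the
  composition of the first \<open>n\<close> kernels, started from the empty history.\<close>

lemma nn_integral_lim_restrict:
  assumes f: "f \<in> borel_measurable (PiM {0..<n} M)"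
  shows "(\<integral>\<^sup>+\<omega>. f (restrict \<omega> {0..<n}) \<partial>PF.lim) = (\<integral>\<^sup>+\<omega>. f \<omega> \<partial>C 0 n (\<lambda>_. undefined))"
proof -
  \<comment> \<open>Hence the projection in the definition of \<open>CI\<close> forgets no
    coordinate and acts as the identity.\<close>
  have "up_to {0..<n} = n"
    using up_to[of "{0..<n}"] up_to_iff_Ico[of "{0..<n}" n] by (cases n) auto
  then have "CI {0..<n} = C 0 n (\<lambda>_. undefined)"
    using distr_C[of n n "\<lambda>_. undefined" 0] by (simp add: CI_def space_PiM)
  then have "distr PF.lim (PiM {0..<n} M) (\<lambda>\<omega>. restrict \<omega> {0..<n}) = C 0 n (\<lambda>_. undefined)"
    using distr_lim[of "{0..<n}"] by simp
  moreover have "(\<lambda>\<omega>. restrict \<omega> {0..<n}) \<in> PF.lim \<rightarrow>\<^sub>M PiM {0..<n} M"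
    unfolding measurable_cong_sets[OF PF.sets_lim refl] by (rule measurable_restrict_subset) simp
  then have "(\<integral>\<^sup>+\<omega>. f (restrict \<omega> {0..<n}) \<partial>PF.lim) =
      (\<integral>\<^sup>+\<omega>. f \<omega> \<partial>distr PF.lim (PiM {0..<n} M) (\<lambda>\<omega>. restrict \<omega> {0..<n}))"
    using f by (subst nn_integral_distr) auto
  ultimately show ?thesis by simp
qed

text \<open>The marginal on the empty index set already carries the total mass.\<close>

lemma prob_space_lim: "prob_space PF.lim"
proof (rule prob_spaceI)
  show "emeasure PF.lim (space PF.lim) = 1"
    using nn_integral_lim_restrict[of "\<lambda>_. 1" 0] by (simp add: space_PiM PF.space_lim sets.top[of "PiM {} M", simplified space_PiM, simplified])
qed

text \<open>The composition of \<open>Suc n\<close> kernels is that of \<open>n\<close> kernels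
  followed by \<open>eP n\<close>, which appends one coordinate drawn from \<open>P n\<close>. Both
  ends are then rewritten as integrals over the limit measure.\<close>

lemma nn_integral_lim_Suc:
  assumes f[measurable]: "f \<in> borel_measurable (PiM {0..<Suc n} M)"
  shows "(\<integral>\<^sup>+\<omega>. f (restrict \<omega> {0..<Suc n}) \<partial>PF.lim) =
    (\<integral>\<^sup>+\<omega>. (\<integral>\<^sup>+y. f ((restrict \<omega> {0..<n})(n := y)) \<partial>P n (restrict \<omega> {0..<n})) \<partial>PF.lim)"
proof -
  have u: "(\<lambda>_. undefined) \<in> space (PiM {0..<0} M)" by (simp add: space_PiM)
  have m: "(\<lambda>\<omega>. \<integral>\<^sup>+\<omega>'. f \<omega>' \<partial>eP n \<omega>) \<in> borel_measurable (PiM {0..<n} M)"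
    by (rule measurable_compose[OF measurable_eP nn_integral_measurable_subprob_algebra[OF f]])
  have "(\<integral>\<^sup>+\<omega>. f (restrict \<omega> {0..<Suc n}) \<partial>PF.lim) = (\<integral>\<^sup>+\<omega>. \<integral>\<^sup>+\<omega>'. f \<omega>' \<partial>eP n \<omega> \<partial>C 0 n (\<lambda>_. undefined))"
    using measurable_eP[of n] sets_C[OF u, of n]
    by (simp only: nn_integral_lim_restrict[OF f] C.simps add_0)
      (subst nn_integral_bind[OF f], auto cong: measurable_cong_sets)
  also have "\<dots> = (\<integral>\<^sup>+\<omega>. \<integral>\<^sup>+\<omega>'. f \<omega>' \<partial>eP n (restrict \<omega> {0..<n}) \<partial>PF.lim)"
    using nn_integral_lim_restrict[OF m] by simp
  also have "\<dots> = (\<integral>\<^sup>+\<omega>. (\<integral>\<^sup>+y. f ((restrict \<omega> {0..<n})(n := y)) \<partial>P n (restrict \<omega> {0..<n})) \<partial>PF.lim)"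
    by (intro nn_integral_cong nn_integral_eP f) (auto simp: space_PiM)
  finally show ?thesis .
qed

end

section \<open>The trajectory law of the jump chain and its Markov property\<close>

context Q_process
begin

context
  fixes x assumes x: "x \<in> S"
begin

lemma jump_kernel_measurable:
  "jump_kernel S q x n \<in> PiM {0..<n} (\<lambda>_. jump_space S) \<rightarrow>\<^sub>M subprob_algebra (jump_space S)"
proof (cases n)
  case 0
  have "(0, Some x) \<in> space (jump_space S)" using x by (simp add: space_jump_space)
  with 0 show ?thesis
    by (simp add: measurable_const space_subprob_algebra prob_space_return prob_space_imp_subprob_space
        cong: measurable_cong)
next
  case (Suc m)
  have "(\<lambda>\<omega>. next_jump S q (\<omega> m)) \<in> PiM {0..<n} (\<lambda>_. jump_space S) \<rightarrow>\<^sub>M subprob_algebra (jump_space S)"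
    using Suc by (intro measurable_compose[OF measurable_component_singleton[of m] next_jump_measurable]) auto
  with Suc show ?thesis by (simp cong: measurable_cong)
qed

lemma prob_space_jump_kernel:
  assumes "\<omega> \<in> space (PiM {0..<n} (\<lambda>_. jump_space S))"
  shows "prob_space (jump_kernel S q x n \<omega>)"
  using assms x
  by (cases n) (auto simp: space_PiM space_jump_space PiE_iff intro!: prob_space_return prob_space_next_jump)

interpretation IT: Ionescu_Tulcea "jump_kernel S q x" "\<lambda>_. jump_space S"
  by (rule Ionescu_Tulcea.intro) (fact jump_kernel_measurable prob_space_jump_kernel)+

lemma jump_process_lim: "jump_process S q x = IT.PF.lim"
  by (simp add: jump_process_def)

lemma sets_jump_process [simp, measurable_cong]:
  "sets (jump_process S q x) = sets (PiM UNIV (\<lambda>_. jump_space S))"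
  by (simp add: jump_process_lim)

lemma space_jump_process [simp]: "space (jump_process S q x) = space (PiM UNIV (\<lambda>_. jump_space S))"
  by (simp add: jump_process_lim)

lemma component_measurable [measurable]: "(\<lambda>\<omega>. \<omega> n) \<in> jump_process S q x \<rightarrow>\<^sub>M jump_space S"
  unfolding measurable_cong_sets[OF sets_jump_process refl] by (rule measurable_component_singleton) simp

lemma jump_process_component: "\<omega> \<in> space (jump_process S q x) \<Longrightarrow> \<omega> n \<in> space (jump_space S)"
  by (auto simp: space_PiM)

lemma nn_integral_jump_process_0:
  assumes f: "f \<in> borel_measurable (jump_space S)"
  shows "(\<integral>\<^sup>+\<omega>. f (\<omega> 0) \<partial>jump_process S q x) = f (0, Some x)"
proof -
  have "(\<lambda>\<omega>. f (\<omega> 0)) \<in> borel_measurable (PiM {0..<Suc 0} (\<lambda>_. jump_space S))"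
    by (rule measurable_compose[OF measurable_component_singleton[of 0] f]) simp
  from IT.nn_integral_lim_Suc[OF this] show ?thesis
    using x f prob_space.emeasure_space_1[OF IT.prob_space_lim]
    by (simp add: jump_process_lim nn_integral_return space_jump_space)
qed

text \<open>This is the Markov property: the kernel drawing coordinate \<open>Suc n\<close> looks at
  the history only through coordinate \<open>n\<close>.\<close>

lemma nn_integral_jump_process_Suc:
  assumes f: "(\<lambda>(s, s'). f s s') \<in> borel_measurable (jump_space S \<Otimes>\<^sub>M jump_space S)"
  shows "(\<integral>\<^sup>+\<omega>. f (\<omega> n) (\<omega> (Suc n)) \<partial>jump_process S q x) =
    (\<integral>\<^sup>+\<omega>. (\<integral>\<^sup>+s'. f (\<omega> n) s' \<partial>next_jump S q (\<omega> n)) \<partial>jump_process S q x)"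
proof -
  have "(\<lambda>\<omega>. (\<lambda>(s, s'). f s s') (\<omega> n, \<omega> (Suc n))) \<in> borel_measurable (PiM {0..<Suc (Suc n)} (\<lambda>_. jump_space S))"
    by (rule measurable_compose[OF measurable_Pair f]) (auto intro!: measurable_component_singleton)
  then have "(\<lambda>\<omega>. f (\<omega> n) (\<omega> (Suc n))) \<in> borel_measurable (PiM {0..<Suc (Suc n)} (\<lambda>_. jump_space S))"
    by simp
  from IT.nn_integral_lim_Suc[OF this] show ?thesis
    by (simp add: jump_process_lim)
qed

lemma prob_space_jump_process: "prob_space (jump_process S q x)"
  unfolding jump_process_lim by (rule IT.prob_space_lim)

end
end

section \<open>Discounted iterates and explosion\<close>

lemma ennreal_exp_shift:
  fixes \<alpha> u t :: real
  shows "ennreal (exp (- \<alpha> * u)) * c = ennreal (exp (- \<alpha> * t)) * (ennreal (exp (- \<alpha> * (u - t))) * c)"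
proof -
  have "exp (- \<alpha> * u) = exp (- \<alpha> * t) * exp (- \<alpha> * (u - t))"
    unfolding exp_add[symmetric] by (simp add: algebra_simps)
  then show ?thesis by (simp add: ennreal_mult' mult.assoc)
qed

text \<open>The value 0 stands for the discount factor at infinite time. A finite bound
  \<open>c\<close> on the times keeps every factor above \<open>exp (- \<alpha> * c)\<close>; if the
  supremum is infinite, some factor lies below \<open>exp (- \<alpha> * real N)\<close> for each
  \<open>N\<close>.\<close>

lemma INF_exp_minus_eq_0_iff:
  fixes T :: "nat \<Rightarrow> ennreal" and \<alpha> :: real
  assumes \<alpha>: "0 < \<alpha>"
  shows "(INF n. if T n < \<infinity> then ennreal (exp (- \<alpha> * enn2real (T n))) else 0) = 0 \<longleftrightarrow> (SUP n. T n) = \<infinity>"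
    (is "(INF n. ?e n) = 0 \<longleftrightarrow> _")
proof
  assume 0: "(INF n. ?e n) = 0"
  show "(SUP n. T n) = \<infinity>"
  proof (rule ccontr)
    assume "(SUP n. T n) \<noteq> \<infinity>"
    then obtain c where c: "0 \<le> c" "(SUP n. T n) = ennreal c"
      by (cases "SUP n. T n") auto
    have "ennreal (exp (- \<alpha> * c)) \<le> (INF n. ?e n)"
    proof (rule INF_greatest)
      fix n
      have le: "T n \<le> ennreal c" using c by (metis SUP_upper UNIV_I)
      then have "T n < \<infinity>" by (metis ennreal_less_top infinity_ennreal_def le_less_trans)
      moreover from le c have "enn2real (T n) \<le> c" by (simp add: enn2real_leI)
      ultimately show "ennreal (exp (- \<alpha> * c)) \<le> ?e n" using \<alpha> by simp
    qed
    with 0 show False by simp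
  qed
next
  assume inf: "(SUP n. T n) = \<infinity>"
  have "(INF n. ?e n) \<le> ennreal (exp (- \<alpha> * real N))" for N
  proof -
    have "ennreal (real N) < (SUP n. T n)" unfolding inf by simp
    then obtain n where n: "ennreal (real N) < T n" unfolding less_SUP_iff by auto
    have "?e n \<le> ennreal (exp (- \<alpha> * real N))"
    proof (cases "T n")
      case (real r)
      with n \<alpha> show ?thesis by (simp add: ennreal_less_iff)
    qed simp
    then show ?thesis by (rule INF_lower2[rotated]) simp
  qed
  moreover have "(\<lambda>N. ennreal (exp (- \<alpha> * real N))) \<longlonglongrightarrow> ennreal 0"
  proof (rule tendsto_ennrealI)
    have "(\<lambda>N. exp (- \<alpha>) ^ N) \<longlonglongrightarrow> 0"
      using \<alpha> by (intro LIMSEQ_power_zero) simp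
    then show "(\<lambda>N. exp (- \<alpha> * real N)) \<longlonglongrightarrow> 0"
      by (simp add: exp_of_nat_mult[symmetric] mult.commute)
  qed
  ultimately show "(INF n. ?e n) = 0"
    using LIMSEQ_le_const[of "\<lambda>N. ennreal (exp (- \<alpha> * real N))" 0 "INF n. ?e n"] by simp
qed

section \<open>The discounting operator, its iterates and their limit\<close>

context Q_process
begin

text \<open>The value \<open>0\<close> off \<open>S\<close> makes the iterates of \<open>disc\<close> from \<open>1\<close> decrease on the whole type.\<close>

definition disc :: "real \<Rightarrow> (real \<Rightarrow> 'a \<Rightarrow> ennreal) \<Rightarrow> real \<Rightarrow> 'a \<Rightarrow> ennreal" where
  "disc \<alpha> \<phi> t x =
    (if x \<in> S then jump_int t x (\<lambda>u y. ennreal (exp (- \<alpha> * (u - t))) * \<phi> u y) else 0)"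

lemma disc_measurable:
  assumes "(\<lambda>(t, x). \<phi> t x) \<in> borel_measurable (borel \<Otimes>\<^sub>M borel_on S)"
  shows "(\<lambda>(t, x). disc \<alpha> \<phi> t x) \<in> borel_measurable (borel \<Otimes>\<^sub>M borel_on S)"
proof -
  have "(\<lambda>p. (snd (fst p), snd p)) \<in> ((borel \<Otimes>\<^sub>M borel_on S) \<Otimes>\<^sub>M borel) \<Otimes>\<^sub>M borel_on S
      \<rightarrow>\<^sub>M borel \<Otimes>\<^sub>M borel_on S"
    by measurable
  from measurable_compose[OF this assms]
  have [measurable]: "(\<lambda>p. \<phi> (snd (fst p)) (snd p))
      \<in> borel_measurable (((borel \<Otimes>\<^sub>M borel_on S) \<Otimes>\<^sub>M borel) \<Otimes>\<^sub>M borel_on S)"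
    by simp
  have "(\<lambda>p. ennreal (exp (- \<alpha> * (snd (fst p) - fst (fst (fst p))))) * \<phi> (snd (fst p)) (snd p))
      \<in> borel_measurable (((borel \<Otimes>\<^sub>M borel_on S) \<Otimes>\<^sub>M borel) \<Otimes>\<^sub>M borel_on S)"
    by measurable
  then have "(\<lambda>p. jump_int (fst p) (snd p) (\<lambda>u y. ennreal (exp (- \<alpha> * (u - fst p))) * \<phi> u y))
      \<in> borel_measurable (borel \<Otimes>\<^sub>M borel_on S)"
    by (intro jump_int_measurable measurable_fst measurable_snd) (simp only: split_beta')
  then show ?thesis
    by (rule measurable_cong[THEN iffD1, rotated]) (auto simp: space_pair_measure disc_def)
qed

lemma disc_mono:
  assumes "\<And>u y. t < u \<Longrightarrow> y \<in> S \<Longrightarrow> \<phi> u y \<le> \<psi> u y"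
  shows "disc \<alpha> \<phi> t x \<le> disc \<alpha> \<psi> t x"
  using assms by (auto simp: disc_def intro!: jump_int_mono mult_left_mono)

lemma disc_le_1:
  assumes "0 < \<alpha>" "\<And>u y. \<phi> u y \<le> 1"
  shows "disc \<alpha> \<phi> t x \<le> 1"
proof (cases "x \<in> S")
  case True
  have "disc \<alpha> \<phi> t x \<le> jump_int t x (\<lambda>_ _. 1)"
    unfolding disc_def using True
    using assms by (auto intro!: jump_int_mono mult_le_one)
  also have "\<dots> \<le> 1" by (rule jump_int_one_le_1[OF True])
  finally show ?thesis .
qed (simp add: disc_def)

primrec disc_iter :: "real \<Rightarrow> nat \<Rightarrow> real \<Rightarrow> 'a \<Rightarrow> ennreal" where
  "disc_iter \<alpha> 0 = (\<lambda>_ _. 1)"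
| "disc_iter \<alpha> (Suc n) = disc \<alpha> (disc_iter \<alpha> n)"

definition disc_lim :: "real \<Rightarrow> real \<Rightarrow> 'a \<Rightarrow> ennreal" where
  "disc_lim \<alpha> t x = (INF n. disc_iter \<alpha> n t x)"

lemma disc_iter_measurable:
  "(\<lambda>(t, x). disc_iter \<alpha> n t x) \<in> borel_measurable (borel \<Otimes>\<^sub>M borel_on S)"
  by (induction n) (auto intro: disc_measurable)

lemma disc_lim_measurable:
  "(\<lambda>(t, x). disc_lim \<alpha> t x) \<in> borel_measurable (borel \<Otimes>\<^sub>M borel_on S)"
  unfolding disc_lim_def using disc_iter_measurable[of \<alpha>] by (simp add: split_beta')

lemma disc_iter_le_1: "0 < \<alpha> \<Longrightarrow> disc_iter \<alpha> n t x \<le> 1"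
  by (induction n arbitrary: t x) (auto intro: disc_le_1)

lemma disc_iter_Suc_le: "0 < \<alpha> \<Longrightarrow> disc_iter \<alpha> (Suc n) t x \<le> disc_iter \<alpha> n t x"
  by (induction n arbitrary: t x) (auto intro: disc_le_1 disc_mono)

lemma disc_lim_le_1: "0 < \<alpha> \<Longrightarrow> disc_lim \<alpha> t x \<le> 1"
  unfolding disc_lim_def by (rule INF_lower2[of 0]) auto

text \<open>The operator passes through the decreasing limit of its iterates, and the shifted
  sequence of iterates has the same infimum.\<close>

lemma disc_disc_lim:
  assumes \<alpha>: "0 < \<alpha>" and x: "x \<in> S"
  shows "disc \<alpha> (disc_lim \<alpha>) t x = disc_lim \<alpha> t x"
proof -
  have dec: "decseq (\<lambda>n. disc_iter \<alpha> n u y)" for u y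
    by (intro decseq_SucI disc_iter_Suc_le \<alpha>)
  \<comment> \<open>\<open>jump_int\<close> sees only \<open>u > t\<close>, where the clamp changes
    nothing; it keeps the factor at most 1 for all \<open>u\<close>, as \<open>jump_int_INF\<close>
    requires.\<close>
  let ?e = "\<lambda>u. ennreal (exp (- \<alpha> * max 0 (u - t)))"
  have "disc \<alpha> \<phi> t x = jump_int t x (\<lambda>u y. ?e u * \<phi> u y)" for \<phi>
    using x by (auto simp: disc_def intro!: jump_int_cong)
  note disc = this
  have "disc \<alpha> (disc_lim \<alpha>) t x = jump_int t x (\<lambda>u y. INF n. ?e u * disc_iter \<alpha> n u y)"
    unfolding disc disc_lim_def by (simp add: ennreal_mult_INF_decseq[OF dec])
  also have "\<dots> = (INF n. jump_int t x (\<lambda>u y. ?e u * disc_iter \<alpha> n u y))"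
  proof (rule jump_int_INF[OF x])
    show "(\<lambda>(u, y). ?e u * disc_iter \<alpha> n u y) \<in> borel_measurable (borel \<Otimes>\<^sub>M borel_on S)" for n
      using disc_iter_measurable[of \<alpha> n] by (simp add: split_beta')
    show "decseq (\<lambda>n. ?e u * disc_iter \<alpha> n u y)" for u y
      using dec[of u y] by (auto simp: decseq_def intro!: mult_left_mono)
    show "?e u * disc_iter \<alpha> n u y \<le> 1" for n u y
      using \<alpha> by (intro mult_le_one disc_iter_le_1) auto
  qed
  also have "\<dots> = (INF n. disc_iter \<alpha> (Suc n) t x)"
    by (simp add: disc)
  also have "\<dots> = disc_lim \<alpha> t x"
    unfolding disc_lim_def
  proof (rule antisym)
    show "(INF n. disc_iter \<alpha> (Suc n) t x) \<le> (INF n. disc_iter \<alpha> n t x)"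
      by (intro INF_mono) (use disc_iter_Suc_le[OF \<alpha>] in blast)
    show "(INF n. disc_iter \<alpha> n t x) \<le> (INF n. disc_iter \<alpha> (Suc n) t x)"
      by (intro INF_greatest INF_lower UNIV_I)
  qed
  finally show ?thesis .
qed

text \<open>For \<open>u > v\<close> the survival factor from \<open>t\<close> to \<open>u\<close>
  is the one from \<open>t\<close> to \<open>v\<close> times the one from \<open>v\<close> to
  \<open>u\<close>. The left-hand side is therefore the part of the right-hand integral that comes
  from jumps after \<open>v\<close>.\<close>

lemma jump_int_restart:
  assumes x: "x \<in> S" and v: "t \<le> v"
    and g: "(\<lambda>(u, y). g u y) \<in> borel_measurable (borel \<Otimes>\<^sub>M borel_on S)"
  shows "ennreal (exp (- (LBINT w:{t..v}. rate x w))) * jump_int v x g \<le> jump_int t x g"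
proof -
  note [measurable] = kern_int_measurable[OF x g] survival_measurable1[OF x]
  obtain M where M: "\<And>u. rate x u \<le> M" using rate_bounded[OF x] by blast
  have split: "(LBINT w:{t..u}. rate x w) = (LBINT w:{t..v}. rate x w) + (LBINT w:{v..u}. rate x w)"
    if "v < u" for u
    using v that by (intro set_integral_rate_split[where M=M]) (auto simp: x M rate_nonneg)
  have "ennreal (exp (- (LBINT w:{t..u}. rate x w)))
      = ennreal (exp (- (LBINT w:{t..v}. rate x w))) * ennreal (exp (- (LBINT w:{v..u}. rate x w)))"
    if "v < u" for u
    unfolding split[OF that] minus_add_distrib exp_add by (simp add: ennreal_mult')
  then have "(\<integral>\<^sup>+u. ennreal (exp (- (LBINT w:{t..v}. rate x w))) * (ennreal (exp (- (LBINT w:{v..u}. rate x w))) *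
      (\<integral>\<^sup>+y. g u y \<partial>kern x u) * indicator {v<..} u) \<partial>lborel) \<le> jump_int t x g"
    unfolding jump_int_def using v
    by (intro nn_integral_mono) (auto simp: mult.assoc split: split_indicator)
  then show ?thesis
    unfolding jump_int_def by (subst nn_integral_cmult[symmetric]) auto
qed

text \<open>The process stays in \<open>x\<close> until time \<open>v\<close> with positive probability.\<close>

lemma disc_lim_start_0:
  assumes \<alpha>: "0 < \<alpha>" and x: "x \<in> S" and v: "0 \<le> v" and nz: "disc_lim \<alpha> v x \<noteq> 0"
  shows "disc_lim \<alpha> 0 x \<noteq> 0"
proof -
  \<comment> \<open>Discounting from time 0 instead of from the starting time costs only a factor
    \<open>exp (\<alpha> * t)\<close> and makes the integrand the same for starts at 0 and at
    \<open>v\<close>, so that they can be compared.\<close>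
  define g where "g = (\<lambda>u y. ennreal (exp (- \<alpha> * u)) * disc_lim \<alpha> u y)"
  have g: "(\<lambda>(u, y). g u y) \<in> borel_measurable (borel \<Otimes>\<^sub>M borel_on S)"
    unfolding g_def using disc_lim_measurable[of \<alpha>] by (simp add: split_beta')
  have e: "ennreal (exp (- \<alpha> * (u - t))) * c = ennreal (exp (\<alpha> * t)) * (ennreal (exp (- \<alpha> * u)) * c)" for u t c
    using ennreal_exp_shift[of \<alpha> "u - t" c "- t"] by simp
  have "disc_lim \<alpha> t x = ennreal (exp (\<alpha> * t)) * jump_int t x g" for t
  proof -
    have "disc_lim \<alpha> t x = jump_int t x (\<lambda>u y. ennreal (exp (\<alpha> * t)) * g u y)"
      unfolding disc_disc_lim[OF \<alpha> x, of t, symmetric] disc_def g_def by (simp only: e x if_True)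
    also have "\<dots> = ennreal (exp (\<alpha> * t)) * jump_int t x g" by (rule jump_int_cmult[OF x g])
    finally show ?thesis .
  qed
  note lim = this
  have "0 < ennreal (exp (- (LBINT w:{0..v}. rate x w))) * jump_int v x g"
    using nz unfolding lim[of v] by (auto simp: ennreal_zero_less_mult_iff zero_less_iff_neq_zero)
  also have "\<dots> \<le> jump_int 0 x g" by (rule jump_int_restart[OF x v g])
  finally show ?thesis by (simp add: lim)
qed

section \<open>Discounted expectations along the jump chain\<close>

definition disc_state :: "real \<Rightarrow> (real \<Rightarrow> 'a \<Rightarrow> ennreal) \<Rightarrow> ennreal \<times> 'a option \<Rightarrow> ennreal" where
  "disc_state \<alpha> \<phi> s = (case snd s of None \<Rightarrow> 0 | Some x \<Rightarrow>
     if fst s < \<infinity> then ennreal (exp (- \<alpha> * enn2real (fst s))) * \<phi> (enn2real (fst s)) x else 0)"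

lemma fst_jump_space_measurable [measurable]: "fst \<in> borel_measurable (jump_space S)"
  and snd_jump_space_measurable [measurable]: "snd \<in> jump_space S \<rightarrow>\<^sub>M cemetery_space S"
  by (simp_all add: jump_space_def)

lemma disc_state_measurable:
  assumes \<phi>: "(\<lambda>(t, x). \<phi> t x) \<in> borel_measurable (borel \<Otimes>\<^sub>M borel_on S)"
  shows "disc_state \<alpha> \<phi> \<in> borel_measurable (jump_space S)"
proof -
  have "(\<lambda>p. (enn2real (fst (fst p)), snd p)) \<in> jump_space S \<Otimes>\<^sub>M borel_on S \<rightarrow>\<^sub>M borel \<Otimes>\<^sub>M borel_on S"
    by measurable
  from measurable_compose[OF this \<phi>]
  have [measurable]: "(\<lambda>p. \<phi> (enn2real (fst (fst p))) (snd p)) \<in> borel_measurable (jump_space S \<Otimes>\<^sub>M borel_on S)"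
    by simp
  have "(\<lambda>p. if fst (fst p) < \<infinity> then ennreal (exp (- \<alpha> * enn2real (fst (fst p)))) * \<phi> (enn2real (fst (fst p))) (snd p) else 0)
      \<in> borel_measurable (jump_space S \<Otimes>\<^sub>M borel_on S)"
    by measurable
  then have "(\<lambda>s. case snd s of None \<Rightarrow> 0 | Some x \<Rightarrow>
     if fst s < \<infinity> then ennreal (exp (- \<alpha> * enn2real (fst s))) * \<phi> (enn2real (fst s)) x else 0)
     \<in> borel_measurable (jump_space S)"
    by (intro measurable_case_cemetery[where S=S] measurable_const S_nonempty snd_jump_space_measurable)
      (simp_all add: split_beta')
  then show ?thesis unfolding disc_state_def[abs_def] .
qed

text \<open>The discount up to \<open>t\<close> times the discount from \<open>t\<close> to the next
  jump is the discount up to that jump. Because \<open>disc_state\<close> vanishes at the cemetery,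
  the atom at \<open>(\<infinity>, None)\<close> contributes nothing.\<close>

lemma nn_integral_disc_state:
  assumes \<phi>: "(\<lambda>(t, x). \<phi> t x) \<in> borel_measurable (borel \<Otimes>\<^sub>M borel_on S)"
    and s: "s \<in> space (jump_space S)"
  shows "(\<integral>\<^sup>+s'. disc_state \<alpha> \<phi> s' \<partial>next_jump S q s) = disc_state \<alpha> (disc \<alpha> \<phi>) s"
proof (cases "snd s")
  case None
  then show ?thesis
    by (simp add: nn_integral_next_jump[OF disc_state_measurable[OF \<phi>] s]) (simp add: disc_state_def)
next
  case (Some x)
  with s have x: "x \<in> S" by (auto simp: space_jump_space)
  define t where "t = enn2real (fst s)"
  have t: "0 \<le> t" by (simp add: t_def)
  have m: "(\<lambda>(u, y). ennreal (exp (- \<alpha> * (u - t))) * \<phi> u y) \<in> borel_measurable (borel \<Otimes>\<^sub>M borel_on S)"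
    using \<phi> by (simp add: split_beta')
  have "jump_int t x (\<lambda>u y. disc_state \<alpha> \<phi> (ennreal u, Some y))
      = jump_int t x (\<lambda>u y. ennreal (exp (- \<alpha> * t)) * (ennreal (exp (- \<alpha> * (u - t))) * \<phi> u y))"
  proof (rule jump_int_cong[OF x])
    fix u y assume "t < u" "y \<in> S"
    with t show "disc_state \<alpha> \<phi> (ennreal u, Some y) = ennreal (exp (- \<alpha> * t)) * (ennreal (exp (- \<alpha> * (u - t))) * \<phi> u y)"
      unfolding ennreal_exp_shift[symmetric] by (simp add: disc_state_def)
  qed
  also have "\<dots> = ennreal (exp (- \<alpha> * t)) * disc \<alpha> \<phi> t x"
    using x by (subst jump_int_cmult[OF x m]) (simp add: disc_def)
  finally show ?thesis
    by (simp add: nn_integral_next_jump[OF disc_state_measurable[OF \<phi>] s] Some)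
      (simp add: disc_state_def Some flip: t_def)
qed

text \<open>By the Markov property the last jump is absorbed into the test function, replacing
  \<open>\<phi>\<close> by \<open>disc \<alpha> \<phi>\<close>; hence the induction over
  \<open>n\<close> keeps \<open>\<phi>\<close> arbitrary.\<close>

lemma nn_integral_jump_process_disc:
  assumes x: "x \<in> S" and \<phi>: "(\<lambda>(t, x). \<phi> t x) \<in> borel_measurable (borel \<Otimes>\<^sub>M borel_on S)"
  shows "(\<integral>\<^sup>+\<omega>. disc_state \<alpha> \<phi> (\<omega> n) \<partial>jump_process S q x) = (disc \<alpha> ^^ n) \<phi> 0 x"
  using \<phi>
proof (induction n arbitrary: \<phi>)
  case 0
  then show ?case
    by (simp add: nn_integral_jump_process_0[OF x] disc_state_measurable) (simp add: disc_state_def)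
next
  case (Suc n)
  have "(\<integral>\<^sup>+\<omega>. disc_state \<alpha> \<phi> (\<omega> (Suc n)) \<partial>jump_process S q x)
      = (\<integral>\<^sup>+\<omega>. (\<integral>\<^sup>+s'. disc_state \<alpha> \<phi> s' \<partial>next_jump S q (\<omega> n)) \<partial>jump_process S q x)"
    by (rule nn_integral_jump_process_Suc[OF x, of "\<lambda>_. disc_state \<alpha> \<phi>"])
      (use disc_state_measurable[OF Suc.prems] in \<open>simp add: split_beta'\<close>)
  also have "\<dots> = (\<integral>\<^sup>+\<omega>. disc_state \<alpha> (disc \<alpha> \<phi>) (\<omega> n) \<partial>jump_process S q x)"
    by (intro nn_integral_cong nn_integral_disc_state Suc.prems jump_process_component[OF x])
  also have "\<dots> = (disc \<alpha> ^^ Suc n) \<phi> 0 x"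
    unfolding funpow_Suc_right comp_def by (intro Suc.IH disc_measurable Suc.prems)
  finally show ?case .
qed

lemma disc_iter_eq_funpow: "disc_iter \<alpha> n = (disc \<alpha> ^^ n) (\<lambda>_ _. 1)"
  by (induction n) auto

section \<open>Almost sure monotonicity of the jump times, and explosion\<close>

lemma AE_jump_process_step:
  assumes x: "x \<in> S"
  shows "AE \<omega> in jump_process S q x. fst (\<omega> n) \<le> fst (\<omega> (Suc n)) \<and>
    (fst (\<omega> (Suc n)) < \<infinity> \<longrightarrow> snd (\<omega> (Suc n)) \<noteq> None)"
proof -
  \<comment> \<open>The indicator of a forbidden transition. \<open>next_jump\<close> charges only
    later times paired with a point of \<open>S\<close>, or \<open>(\<infinity>, None)\<close>, so
    its expectation is zero and it vanishes almost surely.\<close>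
  define bad :: "ennreal \<times> 'a option \<Rightarrow> ennreal \<times> 'a option \<Rightarrow> ennreal" where
    "bad s s' = (if fst s \<le> fst s' \<and> (fst s' < \<infinity> \<longrightarrow> snd s' \<noteq> None) then 0 else 1)" for s s'
  have bad: "(\<lambda>(s, s'). bad s s') \<in> borel_measurable (jump_space S \<Otimes>\<^sub>M jump_space S)"
    unfolding bad_def split_beta' by measurable
  have "(\<integral>\<^sup>+s'. bad s s' \<partial>next_jump S q s) = 0" if s: "s \<in> space (jump_space S)" for s
  proof -
    have m: "bad s \<in> borel_measurable (jump_space S)"
      using measurable_Pair2[OF bad s] by simp
    have "jump_int (enn2real (fst s)) x (\<lambda>u y. bad s (ennreal u, Some y)) = 0"
      if "fst s < \<infinity>" "x \<in> S" for x
    proof -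
      have "fst s \<le> ennreal u" if "enn2real (fst s) < u" for u
        using \<open>fst s < \<infinity>\<close> that by (cases "fst s") (auto intro: ennreal_leI)
      then have "jump_int (enn2real (fst s)) x (\<lambda>u y. bad s (ennreal u, Some y))
          = jump_int (enn2real (fst s)) x (\<lambda>_ _. 0)"
        by (intro jump_int_cong that) (simp add: bad_def)
      then show ?thesis by (simp add: jump_int_def)
    qed
    moreover have "bad s (\<infinity>, None) = 0" by (simp add: bad_def)
    ultimately show ?thesis
      using s unfolding nn_integral_next_jump[OF m s]
      by (auto simp: space_jump_space split: option.split)
  qed
  then have "(\<integral>\<^sup>+\<omega>. bad (\<omega> n) (\<omega> (Suc n)) \<partial>jump_process S q x) = (\<integral>\<^sup>+\<omega>. 0 \<partial>jump_process S q x)"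
    unfolding nn_integral_jump_process_Suc[OF x bad]
    by (intro nn_integral_cong) (use jump_process_component[OF x] in blast)
  moreover have "(\<lambda>\<omega>. bad (\<omega> n) (\<omega> (Suc n))) \<in> borel_measurable (jump_process S q x)"
    using measurable_compose[OF measurable_Pair[OF component_measurable[OF x, of n] component_measurable[OF x, of "Suc n"]] bad]
    by simp
  ultimately have "AE \<omega> in jump_process S q x. bad (\<omega> n) (\<omega> (Suc n)) = 0"
    by (simp add: nn_integral_0_iff_AE)
  then show ?thesis
    by eventually_elim (simp add: bad_def split: if_split_asm)
qed

lemma AE_jump_process_start:
  assumes x: "x \<in> S"
  shows "AE \<omega> in jump_process S q x. snd (\<omega> 0) \<noteq> None"
proof -
  have m: "(\<lambda>s. if snd s = None then 1 else 0 :: ennreal) \<in> borel_measurable (jump_space S)"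
    by measurable
  have "(\<integral>\<^sup>+\<omega>. (if snd (\<omega> 0) = None then 1 else 0) \<partial>jump_process S q x) = 0"
    using nn_integral_jump_process_0[OF x m] by simp
  moreover have "(\<lambda>\<omega>. if snd (\<omega> 0) = None then 1 else 0 :: ennreal) \<in> borel_measurable (jump_process S q x)"
    by (rule measurable_compose[OF component_measurable[OF x, of 0] m])
  ultimately have "AE \<omega> in jump_process S q x. (if snd (\<omega> 0) = None then 1 else 0 :: ennreal) = 0"
    using nn_integral_0_iff_AE by blast
  then show ?thesis by eventually_elim (simp split: if_split_asm)
qed

text \<open>The expected discount at the \<open>n\<close>-th jump is
  \<open>disc_iter \<alpha> n 0 x\<close>. Monotone convergence makes
  \<open>disc_lim \<alpha> 0 x\<close> the expectation of the limiting discount, a nonnegative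
  variable that is zero exactly where the jump times are unbounded.\<close>

lemma AE_explosion_iff:
  assumes x: "x \<in> S" and \<alpha>: "0 < \<alpha>"
  shows "(AE \<omega> in jump_process S q x. explosion_time \<omega> = \<infinity>) \<longleftrightarrow> disc_lim \<alpha> 0 x = 0"
proof -
  let ?M = "jump_process S q x" and ?f = "disc_state \<alpha> (\<lambda>_ _. 1)"
  interpret prob_space ?M by (rule prob_space_jump_process[OF x])
  have m: "(\<lambda>\<omega>. ?f (\<omega> n)) \<in> borel_measurable ?M" for n
    by (rule measurable_compose[OF component_measurable[OF x] disc_state_measurable]) simp
  have "AE \<omega> in ?M. \<forall>n. fst (\<omega> n) \<le> fst (\<omega> (Suc n)) \<and> (fst (\<omega> (Suc n)) < \<infinity> \<longrightarrow> snd (\<omega> (Suc n)) \<noteq> None)"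
    unfolding AE_all_countable by (intro allI AE_jump_process_step x)
  \<comment> \<open>A cemetery state at a finite time would make \<open>disc_state\<close> zero
    without the time being infinite; off a null set this does not occur and the discount depends on
    the time alone.\<close>
  with AE_jump_process_start[OF x]
  have good: "AE \<omega> in ?M. incseq (\<lambda>n. fst (\<omega> n)) \<and> (\<forall>n. fst (\<omega> n) < \<infinity> \<longrightarrow> snd (\<omega> n) \<noteq> None)"
  proof eventually_elim
    case (elim \<omega>)
    then have "fst (\<omega> n) < \<infinity> \<longrightarrow> snd (\<omega> n) \<noteq> None" for n by (cases n) auto
    with elim show ?case by (auto intro: incseq_SucI)
  qed
  have f_eq: "?f (\<omega> n) = (if fst (\<omega> n) < \<infinity> then ennreal (exp (- \<alpha> * enn2real (fst (\<omega> n)))) else 0)"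
    if "\<forall>n. fst (\<omega> n) < \<infinity> \<longrightarrow> snd (\<omega> n) \<noteq> None" for \<omega> n
    using that by (auto simp: disc_state_def split: option.split)
  have dec: "AE \<omega> in ?M. ?f (\<omega> (Suc n)) \<le> ?f (\<omega> n)" for n
    using good
  proof eventually_elim
    case (elim \<omega>)
    then have "fst (\<omega> n) \<le> fst (\<omega> (Suc n))" by (blast dest: incseq_SucD)
    moreover from this have "fst (\<omega> (Suc n)) < \<infinity> \<Longrightarrow> fst (\<omega> n) < \<infinity>" by (rule le_less_trans)
    ultimately show ?case
      using elim \<alpha> by (simp add: f_eq enn2real_mono)
  qed
  have int: "(\<integral>\<^sup>+\<omega>. ?f (\<omega> n) \<partial>?M) = disc_iter \<alpha> n 0 x" for n
    unfolding disc_iter_eq_funpow by (rule nn_integral_jump_process_disc[OF x]) simp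
  \<comment> \<open>Decreasing convergence needs a finite integral to start from;
    \<open>int[of 0]\<close> gives the value 1.\<close>
  have "(\<integral>\<^sup>+\<omega>. (INF n. ?f (\<omega> n)) \<partial>?M) = (INF n. \<integral>\<^sup>+\<omega>. ?f (\<omega> n) \<partial>?M)"
    by (rule nn_integral_monotone_convergence_INF_AE') (use m dec int[of 0] in auto)
  also have "\<dots> = disc_lim \<alpha> 0 x" by (simp add: int disc_lim_def)
  finally have "disc_lim \<alpha> 0 x = 0 \<longleftrightarrow> (AE \<omega> in ?M. (INF n. ?f (\<omega> n)) = 0)"
    using m by (subst nn_integral_0_iff_AE[symmetric]) auto
  also have "\<dots> \<longleftrightarrow> (AE \<omega> in ?M. explosion_time \<omega> = \<infinity>)"
  proof (rule eventually_subst)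
    show "AE \<omega> in ?M. ((INF n. ?f (\<omega> n)) = 0) = (explosion_time \<omega> = \<infinity>)"
      using good
    proof eventually_elim
      case (elim \<omega>)
      \<comment> \<open>On a trajectory with increasing times the sequence converges, so
        \<open>lim\<close> is a genuine limit and equals the supremum.\<close>
      then have "explosion_time \<omega> = (SUP n. fst (\<omega> n))"
        unfolding explosion_time_def by (intro limI LIMSEQ_SUP) simp
      then show ?case
        using elim INF_exp_minus_eq_0_iff[OF \<alpha>, of "\<lambda>n. fst (\<omega> n)"] by (simp add: f_eq)
    qed
  qed
  finally show ?thesis by simp
qed

text \<open>Explosion does not refer to \<open>\<alpha>\<close>, so one criterion serves every
  positive discount rate. Probability below 1 is the failure of the almost sure statement, the event
  being measurable.\<close>

lemma explosive_iff:
  assumes \<alpha>: "0 < \<alpha>"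
  shows "explosive S q \<longleftrightarrow> (\<exists>x\<in>S. disc_lim \<alpha> 0 x \<noteq> 0)"
proof -
  have "\<P>(\<omega> in jump_process S q x. explosion_time \<omega> = \<infinity>) < 1 \<longleftrightarrow> disc_lim \<alpha> 0 x \<noteq> 0"
    if x: "x \<in> S" for x
  proof -
    interpret prob_space "jump_process S q x" by (rule prob_space_jump_process[OF x])
    have [measurable]: "(\<lambda>\<omega>. fst (\<omega> n)) \<in> borel_measurable (jump_process S q x)" for n
      by (rule measurable_compose[OF component_measurable[OF x]]) measurable
    have "{\<omega> \<in> space (jump_process S q x). explosion_time \<omega> = \<infinity>} \<in> sets (jump_process S q x)"
      unfolding explosion_time_def by measurable
    from prob_Collect_eq_1[OF this] AE_explosion_iff[OF x \<alpha>] show ?thesis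
      using prob_le_1[of "{\<omega> \<in> space (jump_process S q x). explosion_time \<omega> = \<infinity>}"] by linarith
  qed
  then show ?thesis unfolding explosive_def by blast
qed

section \<open>The integral inequality and its bounded subsolutions\<close>

lemma disc_eq_integral:
  assumes x: "x \<in> S" and v: "0 \<le> v"
    and \<phi>: "(\<lambda>(t, x). \<phi> t x) \<in> borel_measurable (borel \<Otimes>\<^sub>M borel_on S)"
  shows "disc \<alpha> \<phi> v x =
    (\<integral>\<^sup>+t\<in>{0..}. (\<integral>\<^sup>+y. \<phi> (v + t) y \<partial>q_tilde S q x (v + t)) *
      ennreal (exp (- \<alpha> * t - (LBINT s:{0..t}. q_rate q x (s + v)))) \<partial>lborel)"
proof -
  have m: "(\<lambda>(u, y). ennreal (exp (- \<alpha> * (u - v))) * \<phi> u y) \<in> borel_measurable (borel \<Otimes>\<^sub>M borel_on S)"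
    using \<phi> by (simp add: split_beta')
  have A: "(LBINT w:{v..v + t}. rate x w) = (LBINT s:{0..t}. q_rate q x (s + v))" for t
  proof -
    have "(LBINT w:{v..v + t}. rate x w) = (LBINT s. indicator {v..v + t} (v + s) *\<^sub>R rate x (v + s))"
      unfolding set_lebesgue_integral_def
      using lborel_integral_real_affine[of 1 "\<lambda>w. indicator {v..v + t} w *\<^sub>R rate x w" v] by simp
    also have "\<dots> = (LBINT s:{0..t}. q_rate q x (s + v))"
      unfolding set_lebesgue_integral_def using v
      by (intro Bochner_Integration.integral_cong) (auto simp: rate_eq add.commute split: split_indicator)
    finally show ?thesis .
  qed
  have "(\<lambda>u. ennreal (exp (- (LBINT w:{v..u}. rate x w))) *
      (\<integral>\<^sup>+y. ennreal (exp (- \<alpha> * (u - v))) * \<phi> u y \<partial>kern x u) * indicator {v<..} u) \<in> borel_measurable borel"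
    by (intro borel_measurable_times_ennreal kern_int_measurable[OF x m] borel_measurable_indicator
        measurable_compose[OF survival_measurable1[OF x, of v], of "\<lambda>r. ennreal (exp (- r))"]) auto
  \<comment> \<open>Substitution \<open>u = v + t\<close>, from absolute time to time elapsed since
    \<open>v\<close>.\<close>
  from nn_integral_real_affine[OF this, of 1 v]
  have "disc \<alpha> \<phi> v x = (\<integral>\<^sup>+t. ennreal (exp (- (LBINT w:{v..v + t}. rate x w))) *
     (\<integral>\<^sup>+y. ennreal (exp (- \<alpha> * (v + t - v))) * \<phi> (v + t) y \<partial>kern x (v + t)) * indicator {v<..} (v + t) \<partial>lborel)"
    using x by (simp only: disc_def jump_int_def if_True) simp
  also have "\<dots> = (\<integral>\<^sup>+t\<in>{0..}. (\<integral>\<^sup>+y. \<phi> (v + t) y \<partial>q_tilde S q x (v + t)) *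
      ennreal (exp (- \<alpha> * t - (LBINT s:{0..t}. q_rate q x (s + v)))) \<partial>lborel)"
  proof (rule nn_integral_cong_AE)
    \<comment> \<open>One integral is over \<open>t > 0\<close>, the other over
      \<open>t \<ge> 0\<close>; they agree off the null set \<open>{0}\<close>. For
      \<open>t > 0\<close> the clamped kernel is the original one, since \<open>v\<close> is
      nonnegative.\<close>
    show "AE t in lborel. ennreal (exp (- (LBINT w:{v..v + t}. rate x w))) *
       (\<integral>\<^sup>+y. ennreal (exp (- \<alpha> * (v + t - v))) * \<phi> (v + t) y \<partial>kern x (v + t)) * indicator {v<..} (v + t)
      = (\<integral>\<^sup>+y. \<phi> (v + t) y \<partial>q_tilde S q x (v + t)) *
      ennreal (exp (- \<alpha> * t - (LBINT s:{0..t}. q_rate q x (s + v)))) * indicator {0..} t"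
      using AE_lborel_singleton[of 0]
    proof eventually_elim
      case (elim t)
      have "(\<integral>\<^sup>+y. ennreal (exp (- \<alpha> * t)) * \<phi> (v + t) y \<partial>kern x (v + t))
          = ennreal (exp (- \<alpha> * t)) * (\<integral>\<^sup>+y. \<phi> (v + t) y \<partial>kern x (v + t))"
        by (intro nn_integral_cmult kern_fun_measurable[OF x \<phi>])
      moreover have "exp (- \<alpha> * t - (LBINT s:{0..t}. q_rate q x (s + v)))
          = exp (- (LBINT s:{0..t}. q_rate q x (s + v))) * exp (- \<alpha> * t)"
        unfolding exp_add[symmetric] by (simp add: algebra_simps)
      ultimately show ?case
        unfolding A using elim v
        by (auto simp: kern_eq ennreal_mult' mult_ac split: split_indicator)
    qed
  qed
  finally show ?thesis .
qed

text \<open>The bound by \<open>C\<close> is the case of zero iterates. Applying the monotone and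
  homogeneous operator to both sides of \<open>\<phi> \<le> C * disc_iter \<alpha> n\<close> gives
  the next case, and finiteness of \<open>C\<close> lets the infimum pass through the
  product.\<close>

lemma subsolution_le_disc_lim:
  assumes \<alpha>: "0 < \<alpha>" and C: "\<And>v x. 0 \<le> v \<Longrightarrow> x \<in> S \<Longrightarrow> \<phi> v x \<le> C" "C < \<infinity>"
    and sub: "\<And>v x. 0 \<le> v \<Longrightarrow> x \<in> S \<Longrightarrow> \<phi> v x \<le> disc \<alpha> \<phi> v x"
    and vx: "0 \<le> v" "x \<in> S"
  shows "\<phi> v x \<le> C * disc_lim \<alpha> v x"
proof -
  have "\<phi> v x \<le> C * disc_iter \<alpha> n v x" if "0 \<le> v" "x \<in> S" for n v x
    using that
  proof (induction n arbitrary: v x)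
    case (Suc n)
    have m: "(\<lambda>(u, y). ennreal (exp (- \<alpha> * (u - v))) * disc_iter \<alpha> n u y) \<in> borel_measurable (borel \<Otimes>\<^sub>M borel_on S)"
      using disc_iter_measurable[of \<alpha> n] by (simp add: split_beta')
    have "\<phi> v x \<le> disc \<alpha> \<phi> v x" by (intro sub Suc.prems)
    also have "\<dots> \<le> disc \<alpha> (\<lambda>u y. C * disc_iter \<alpha> n u y) v x"
      using Suc.prems by (intro disc_mono Suc.IH) auto
    also have "\<dots> = jump_int v x (\<lambda>u y. C * (ennreal (exp (- \<alpha> * (u - v))) * disc_iter \<alpha> n u y))"
      using Suc.prems by (simp add: disc_def mult_ac)
    also have "\<dots> = C * disc_iter \<alpha> (Suc n) v x"
      using Suc.prems by (subst jump_int_cmult[OF _ m]) (simp_all add: disc_def)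
    finally show ?case .
  qed (use C in simp)
  then have "\<phi> v x \<le> (INF n. C * disc_iter \<alpha> n v x)"
    using vx by (intro INF_greatest)
  also have "\<dots> = C * disc_lim \<alpha> v x"
    unfolding disc_lim_def using C \<alpha>
    by (intro ennreal_mult_INF_decseq[symmetric] decseq_SucI disc_iter_Suc_le) auto
  finally show ?thesis .
qed

end

section \<open>Equivalence of explosion with a nontrivial bounded subsolution\<close>

theorem corollary3p1:
  fixes S :: "'a::polish_space set"
    and q :: "'a \<Rightarrow> real \<Rightarrow> 'a set \<Rightarrow> real"
  assumes "S \<in> sets borel" and "S \<noteq> {}"
    and "Q_function S q"
  shows "explosive S q \<longleftrightarrow>
    (\<exists>\<alpha>>0. \<exists>U :: real \<Rightarrow> 'a \<Rightarrow> real.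
       (\<lambda>(v, x). U v x) \<in> borel_measurable (borel_on {0..} \<Otimes>\<^sub>M borel_on S) \<and>
       (\<forall>v\<ge>0. \<forall>x\<in>S. 0 \<le> U v x) \<and>
       (\<exists>C. \<forall>v\<ge>0. \<forall>x\<in>S. U v x \<le> C) \<and>
       (\<exists>v\<ge>0. \<exists>x\<in>S. U v x \<noteq> 0) \<and>
       (\<forall>x\<in>S. \<forall>v\<ge>0.
          ennreal (U v x) \<le>
            (\<integral>\<^sup>+t\<in>{0..}. (\<integral>\<^sup>+y. ennreal (U (v + t) y) \<partial>q_tilde S q x (v + t)) *
               ennreal (exp (- \<alpha> * t - (LBINT s:{0..t}. q_rate q x (s + v)))) \<partial>lborel)))"
    (is "_ \<longleftrightarrow> (\<exists>\<alpha>>0. \<exists>U. ?sol \<alpha> U)")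
proof -
  interpret Q_process S q using assms by unfold_locales
  show ?thesis
  proof
    assume "explosive S q"
    \<comment> \<open>Any positive discount rate would do, by \<open>explosive_iff\<close>; here it
      is 1.\<close>
    then obtain x0 where x0: "x0 \<in> S" "disc_lim 1 0 x0 \<noteq> 0" using explosive_iff[of 1] by auto
    \<comment> \<open>The limit of the iterates is a fixed point of the operator and bounded by 1,
      so passing to real values loses nothing.\<close>
    define U where "U v x = enn2real (disc_lim 1 v x)" for v x
    have U: "ennreal (U v x) = disc_lim 1 v x" for v x
      using disc_lim_le_1[of 1 v x] unfolding U_def
      by (intro ennreal_enn2real) (auto intro: le_less_trans)
    have "(\<lambda>p. (fst p, snd p)) \<in> borel_on {0::real..} \<Otimes>\<^sub>M borel_on S \<rightarrow>\<^sub>M borel \<Otimes>\<^sub>M borel_on S"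
      by (intro measurable_Pair measurable_snd measurable_compose[OF measurable_fst] measurable_restrict_space1) simp
    from measurable_compose[OF this disc_lim_measurable[of 1]]
    have U_meas: "(\<lambda>(v, x). U v x) \<in> borel_measurable (borel_on {0..} \<Otimes>\<^sub>M borel_on S)"
      by (simp add: U_def split_beta')
    have U_le: "U v x \<le> 1" for v x
      using disc_lim_le_1[of 1 v x] by (simp flip: U)
    have U_x0: "U 0 x0 \<noteq> 0" using x0 U[of 0 x0] by auto
    have U_sub: "ennreal (U v x) \<le>
            (\<integral>\<^sup>+t\<in>{0..}. (\<integral>\<^sup>+y. ennreal (U (v + t) y) \<partial>q_tilde S q x (v + t)) *
               ennreal (exp (- 1 * t - (LBINT s:{0..t}. q_rate q x (s + v)))) \<partial>lborel)"
      if "x \<in> S" "0 \<le> v" for x v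
      using disc_eq_integral[OF that disc_lim_measurable[of 1], of 1] disc_disc_lim[of 1 x v] that by (simp add: U)
    have "?sol 1 U"
    proof (intro conjI ballI allI impI)
      show "\<exists>C. \<forall>v\<ge>0. \<forall>x\<in>S. U v x \<le> C" using U_le by blast
      show "\<exists>v\<ge>0. \<exists>x\<in>S. U v x \<noteq> 0" using U_x0 x0(1) order_refl[of "0::real"] by blast
    qed (use U_meas U_sub in \<open>simp_all add: U_def\<close>)
    from conjI[OF zero_less_one exI[of "?sol 1" U, OF this]]
    show "\<exists>\<alpha>>0. \<exists>U. ?sol \<alpha> U" by (rule exI[of _ 1])
  next
    assume "\<exists>\<alpha>>0. \<exists>U. ?sol \<alpha> U"
    then obtain \<alpha> where \<alpha>U: "0 < \<alpha> \<and> (\<exists>U. ?sol \<alpha> U)" ..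
    note \<alpha> = conjunct1[OF \<alpha>U]
    from conjunct2[OF \<alpha>U] obtain U where sol: "?sol \<alpha> U" ..
    note U = sol[THEN conjunct1]
      and U0 = sol[THEN conjunct2, THEN conjunct1, rule_format]
      and sub = sol[THEN conjunct2, THEN conjunct2, THEN conjunct2, THEN conjunct2, rule_format]
    from sol[THEN conjunct2, THEN conjunct2, THEN conjunct1]
    obtain C where C: "\<And>v x. 0 \<le> v \<Longrightarrow> x \<in> S \<Longrightarrow> U v x \<le> C" by blast
    from sol[THEN conjunct2, THEN conjunct2, THEN conjunct2, THEN conjunct1]
    obtain v x where vx: "0 \<le> v" "x \<in> S" "U v x \<noteq> 0" by blast
    \<comment> \<open>Clamping extends \<open>U\<close> to negative times so that it becomes a
      measurable function on the whole line; its values at \<open>v \<ge> 0\<close> are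
      unchanged.\<close>
    define \<phi> where "\<phi> v x = ennreal (U (max 0 v) x)" for v x
    have "(\<lambda>p. (max 0 (fst p), snd p)) \<in> borel \<Otimes>\<^sub>M borel_on S \<rightarrow>\<^sub>M borel_on {0::real..} \<Otimes>\<^sub>M borel_on S"
      by (intro measurable_Pair measurable_snd measurable_restrict_space2) auto
    from measurable_compose[OF this U]
    have \<phi>: "(\<lambda>(v, x). \<phi> v x) \<in> borel_measurable (borel \<Otimes>\<^sub>M borel_on S)"
      by (simp add: \<phi>_def split_beta')
    have "\<phi> v x \<le> disc \<alpha> \<phi> v x" if "0 \<le> v" "x \<in> S" for v x
    proof -
      have "(\<integral>\<^sup>+t\<in>{0..}. (\<integral>\<^sup>+y. ennreal (U (v + t) y) \<partial>q_tilde S q x (v + t)) *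
               ennreal (exp (- \<alpha> * t - (LBINT s:{0..t}. q_rate q x (s + v)))) \<partial>lborel) =
         (\<integral>\<^sup>+t\<in>{0..}. (\<integral>\<^sup>+y. \<phi> (v + t) y \<partial>q_tilde S q x (v + t)) *
               ennreal (exp (- \<alpha> * t - (LBINT s:{0..t}. q_rate q x (s + v)))) \<partial>lborel)"
        using that by (intro nn_integral_cong) (auto simp: \<phi>_def split: split_indicator)
      with sub[OF that(2,1)] that show ?thesis
        by (simp add: disc_eq_integral[OF that(2,1) \<phi>] \<phi>_def)
    qed
    from subsolution_le_disc_lim[of \<alpha> \<phi> "ennreal C", OF \<alpha> _ _ this vx(1,2)] C
    have "\<phi> v x \<le> ennreal C * disc_lim \<alpha> v x" by (auto simp: \<phi>_def intro: ennreal_leI)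
    \<comment> \<open>\<open>ennreal\<close> sends negative reals to 0; nonnegativity of
      \<open>U\<close> is what keeps a nonzero value nonzero.\<close>
    moreover have "\<phi> v x \<noteq> 0" using vx U0[OF vx(1,2)] by (simp add: \<phi>_def ennreal_eq_0_iff)
    ultimately have "disc_lim \<alpha> v x \<noteq> 0" by auto
    \<comment> \<open>Explosion concerns starts at time 0, whereas \<open>U\<close> may be nonzero
      only at a later \<open>v\<close>; the positive chance of resting in \<open>x\<close> until
      \<open>v\<close> bridges the two.\<close>
    with disc_lim_start_0[OF \<alpha> vx(2,1)] vx(2) show "explosive S q"
      unfolding explosive_iff[OF \<alpha>] by blast
  qed
qed

end
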